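(* Let $\mathcal{F}$ be a germ of singular holomorphic foliation at $(\mathbb{C}^2,0)$, and let $C$ be a reduced curve of separatrices of $\mathcal{F}$. Then $$\tau^k(\mathcal{F},C)-\tau^k(C)=\operatorname{GSV}(\mathcal{F},C)\qquad\text{for all integers } k\ge 0.$$
   Context: $\mathcal{O}_2=\mathbb{C}\{x,y\}$ is the ring of germs of holomorphic functions at $0\in\mathbb{C}^2$, $\mathfrak{m}$ is its maximal ideal, and $\mathfrak{m}^0=\mathcal{O}_2$. A germ of singular foliation $\mathcal{F}$ is given by $\omega=P\,dx+Q\,dy$ with $P,Q\in\mathfrak{m}$ relatively prime. A curve $C=\{f=0\}$, $f\in\mathcal{O}_2$, is $\mathcal{F}$-invariant if $\omega\wedge df=f\,h\,dx\wedge dy$ for some $h\in\mathcal{O}_2$; a separatrix is an irreducible invariant curve, and a reduced curve of separatrices is a reduced curve $C=\{f=0\}$ ($f$ a reduced equation) that is a finite union of separatrices. For $k\ge0$: $\tau^k(\mathcal{F},C)=\dim_{\mathbb{C}}\mathcal{O}_2/(\langle P,Q\rangle\mathfrak{m}^k+\langle f\rangle)$ and $\tau^k(C)=\dim_{\mathbb{C}}\mathcal{O}_2/(\langle f_x,f_y\rangle\mathfrak{m}^k+\langle f\rangle)$. There exist $g,h\in\mathcal{O}_2$, each relatively prime to $f$, and a holomorphic 1-form $\eta$ such that $g\omega=h\,df+f\eta$; the Gómez-Mont–Seade–Verjovsky index is $\operatorname{GSV}(\mathcal{F},C)=i(f,h)-i(f,g)$ (independent of choices), where $i(a,b)=\dim_{\mathbb{C}}\mathcal{O}_2/\langle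 a,b\rangle$. *)

theory Defs
  imports "HOL-Analysis.Infinite_Sum" "HOL-Library.Product_Plus" "HOL-Library.Extended_Nat"
    "HOL-Computational_Algebra.Computational_Algebra"
begin

section \<open>The ring of convergent power series in two variables\<close>

text \<open>
  A formal power series \<open>F\<close> in \<open>x, y\<close> has type \<^typ>\<open>complex fps fps\<close>; the outer index is
  the exponent of \<open>y\<close>, so \<open>F $ j $ i\<close> is the coefficient of \<open>x^i y^j\<close>.  It is convergent
  if it converges absolutely at some point \<open>(r, r)\<close> with \<open>r > 0\<close>, that is, on some
  polydisc around the origin.  A germ of a holomorphic function at the origin of the complex
  plane \<open>C^2\<close> is identified with its Taylor series.
\<close>

definition convergent2 :: "complex fps fps \<Rightarrow> bool" where
  "convergent2 F \<longleftrightarrow>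
     (\<exists>r>0. (\<lambda>(i, j). norm (F $ j $ i) * r ^ i * r ^ j) summable_on (UNIV :: (nat \<times> nat) set))"

lemma convergent2_iff_bound:
  "convergent2 F \<longleftrightarrow> (\<exists>C R. R > 0 \<and> (\<forall>i j. norm (F $ j $ i) \<le> C * R ^ i * R ^ j))"
proof
  assume "convergent2 F"
  then obtain r :: real where r: "r > 0"
    and s: "(\<lambda>(i, j). norm (F $ j $ i) * r ^ i * r ^ j) summable_on (UNIV :: (nat \<times> nat) set)"
    unfolding convergent2_def by blast
  define g where "g = (\<lambda>(i, j). norm (F $ j $ i) * r ^ i * r ^ j)"
  have gnn: "g p \<ge> 0" for p using r by (auto simp: g_def split: prod.splits)
  have s': "g summable_on UNIV" using s by (simp add: g_def)
  have le: "g p \<le> infsum g UNIV" for p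
    using finite_sum_le_infsum[OF s', of "{p}"] gnn by simp
  have "norm (F $ j $ i) \<le> infsum g UNIV * (1/r) ^ i * (1/r) ^ j" for i j
    using le[of "(i, j)"] r by (simp add: g_def field_simps power_one_over)
  then show "\<exists>C R. R > 0 \<and> (\<forall>i j. norm (F $ j $ i) \<le> C * R ^ i * R ^ j)"
    using r by (intro exI[of _ "infsum g UNIV"] exI[of _ "1/r"]) simp
next
  assume "\<exists>C R. R > 0 \<and> (\<forall>i j. norm (F $ j $ i) \<le> C * R ^ i * R ^ j)"
  then obtain C R :: real where R: "R > 0" and b: "\<And>i j. norm (F $ j $ i) \<le> C * R ^ i * R ^ j"
    by blast
  define r where "r = 1 / (2 * R)"
  have r: "r > 0" using R by (simp add: r_def)
  have Rr: "R * r = 1/2" using R by (simp add: r_def)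
  have geo: "(\<lambda>n. (1/2::real) ^ n) summable_on UNIV"
    by (rule norm_summable_imp_summable_on) (simp add: power_abs summable_geometric)
  have "(\<lambda>(i, j). (1/2::real) ^ i * (1/2) ^ j) summable_on (UNIV \<times> UNIV)"
    by (rule summable_on_SigmaI[where g = "\<lambda>i. (1/2::real) ^ i * infsum (\<lambda>j. (1/2) ^ j) UNIV"])
       (auto intro!: has_sum_cmult_right has_sum_infsum summable_on_cmult_left geo)
  then have "(\<lambda>p. C * (case p of (i, j) \<Rightarrow> (1/2::real) ^ i * (1/2) ^ j)) summable_on (UNIV \<times> UNIV)"
    by (rule summable_on_cmult_right)
  then have sm: "(\<lambda>p. C * (case p of (i, j) \<Rightarrow> (1/2::real) ^ i * (1/2) ^ j)) summable_on UNIV"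
    by simp
  have "(\<lambda>(i, j). norm (F $ j $ i) * r ^ i * r ^ j) summable_on (UNIV :: (nat \<times> nat) set)"
  proof (rule summable_on_comparison_test[OF sm])
    fix p :: "nat \<times> nat"
    obtain i j where p: "p = (i, j)" by (cases p)
    have "norm (F $ j $ i) * (r ^ i * r ^ j) \<le> C * R ^ i * R ^ j * (r ^ i * r ^ j)"
      using b r by (intro mult_right_mono) auto
    also have "\<dots> = C * (R * r) ^ i * (R * r) ^ j"
      by (simp add: power_mult_distrib algebra_simps)
    finally show "(case p of (i, j) \<Rightarrow> norm (F $ j $ i) * r ^ i * r ^ j)
        \<le> C * (case p of (i, j) \<Rightarrow> (1/2) ^ i * (1/2) ^ j)"
      by (simp add: p Rr mult.assoc)
  qed (use r in auto)
  then show "convergent2 F" unfolding convergent2_def using r by blast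
qed

lemma convergent2I:
  assumes "R > 0" "\<And>i j. norm (F $ j $ i) \<le> C * R ^ i * R ^ j"
  shows "convergent2 F"
  using assms convergent2_iff_bound by blast

lemma convergent2E:
  assumes "convergent2 F"
  obtains C R where "C \<ge> 0" "R \<ge> 1" "\<And>i j. norm (F $ j $ i) \<le> C * R ^ i * R ^ j"
proof -
  from assms obtain C R :: real where R: "R > 0" and b: "\<And>i j. norm (F $ j $ i) \<le> C * R ^ i * R ^ j"
    unfolding convergent2_iff_bound by blast
  have C: "C \<ge> 0" using order_trans[OF norm_ge_zero b[of 0 0]] by simp
  have "C * R ^ i * R ^ j \<le> C * (max R 1) ^ i * (max R 1) ^ j" for i j
    using R C by (intro mult_mono power_mono) auto
  then show ?thesis using that[of C "max R 1"] C b order_trans by fastforce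
qed

lemma convergent2_const: "convergent2 (fps_const (fps_const c))"
  by (rule convergent2I[of 1 _ "norm c"]) (auto simp: fps_const_def)

lemma convergent2_uminus: "convergent2 F \<Longrightarrow> convergent2 (- F)"
  unfolding convergent2_iff_bound by simp

lemma convergent2_add:
  assumes "convergent2 F" "convergent2 G"
  shows "convergent2 (F + G)"
proof -
  obtain C R where F: "C \<ge> 0" "R \<ge> 1" "\<And>i j. norm (F $ j $ i) \<le> C * R ^ i * R ^ j"
    using convergent2E[OF assms(1)] by blast
  obtain D S where G: "D \<ge> 0" "S \<ge> 1" "\<And>i j. norm (G $ j $ i) \<le> D * S ^ i * S ^ j"
    using convergent2E[OF assms(2)] by blast
  define T where "T = max R S"
  show ?thesis
  proof (rule convergent2I[of T _ "C + D"])
    show "T > 0" using F(2) by (simp add: T_def)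
    fix i j
    have "norm ((F + G) $ j $ i) \<le> C * R ^ i * R ^ j + D * S ^ i * S ^ j"
      using norm_triangle_mono[OF F(3) G(3)] by simp
    also have "\<dots> \<le> C * T ^ i * T ^ j + D * T ^ i * T ^ j"
      using F G by (intro add_mono mult_mono power_mono) (auto simp: T_def)
    finally show "norm ((F + G) $ j $ i) \<le> (C + D) * T ^ i * T ^ j"
      by (simp add: algebra_simps)
  qed
qed

lemma real_Suc_le_power2: "real (Suc n) \<le> 2 ^ n"
  using Bernoulli_inequality[of 1 n] by simp

lemma convergent2_mult:
  assumes "convergent2 F" "convergent2 G"
  shows "convergent2 (F * G)"
proof -
  obtain C R where F: "C \<ge> 0" "R \<ge> 1" "\<And>i j. norm (F $ j $ i) \<le> C * R ^ i * R ^ j"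
    using convergent2E[OF assms(1)] by blast
  obtain D S where G: "D \<ge> 0" "S \<ge> 1" "\<And>i j. norm (G $ j $ i) \<le> D * S ^ i * S ^ j"
    using convergent2E[OF assms(2)] by blast
  define T where "T = max R S"
  have T: "T \<ge> 1" using F(2) by (simp add: T_def)
  show ?thesis
  proof (rule convergent2I[of "2 * T" _ "C * D"])
    show "2 * T > 0" using T by simp
    fix i j
    have "norm ((F * G) $ j $ i)
        = norm (\<Sum>b=0..j. \<Sum>a=0..i. F $ b $ a * G $ (j - b) $ (i - a))"
      by (simp add: fps_mult_nth fps_sum_nth)
    also have "\<dots> \<le> (\<Sum>b=0..j. \<Sum>a=0..i. norm (F $ b $ a * G $ (j - b) $ (i - a)))"
      by (intro order_trans[OF norm_sum] sum_mono order_refl)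
    also have "\<dots> \<le> (\<Sum>b=0..j. \<Sum>a=0..i. C * D * T ^ i * T ^ j)"
    proof (intro sum_mono)
      fix a b assume ab: "b \<in> {0..j}" "a \<in> {0..i}"
      have "norm (F $ b $ a * G $ (j - b) $ (i - a))
          \<le> (C * R ^ a * R ^ b) * (D * S ^ (i - a) * S ^ (j - b))"
        unfolding norm_mult using F G by (intro mult_mono) auto
      also have "\<dots> \<le> (C * T ^ a * T ^ b) * (D * T ^ (i - a) * T ^ (j - b))"
        using F G by (intro mult_mono power_mono) (auto simp: T_def)
      also have "\<dots> = C * D * (T ^ a * T ^ (i - a)) * (T ^ b * T ^ (j - b))"
        by (simp add: mult_ac)
      also have "\<dots> = C * D * T ^ i * T ^ j"
        using ab by (simp flip: power_add)
      finally show "norm (F $ b $ a * G $ (j - b) $ (i - a)) \<le> C * D * T ^ i * T ^ j" .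
    qed
    also have "\<dots> = (C * D * T ^ i * T ^ j) * (real (Suc i) * real (Suc j))"
      by (simp add: algebra_simps)
    also have "\<dots> \<le> (C * D * T ^ i * T ^ j) * (2 ^ i * 2 ^ j)"
      using F G T by (intro mult_left_mono mult_mono real_Suc_le_power2) auto
    finally show "norm ((F * G) $ j $ i) \<le> C * D * (2 * T) ^ i * (2 * T) ^ j"
      by (simp add: power_mult_distrib mult_ac)
  qed
qed

definition fps2_deriv_x :: "complex fps fps \<Rightarrow> complex fps fps" where
  "fps2_deriv_x F = Abs_fps (\<lambda>j. fps_deriv (F $ j))"

definition fps2_deriv_y :: "complex fps fps \<Rightarrow> complex fps fps" where
  "fps2_deriv_y F = fps_deriv F"

lemma convergent2_deriv:
  assumes "convergent2 F"
  shows "convergent2 (fps2_deriv_x F)" "convergent2 (fps2_deriv_y F)"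
proof -
  obtain C R where F: "C \<ge> 0" "R \<ge> 1" "\<And>i j. norm (F $ j $ i) \<le> C * R ^ i * R ^ j"
    using convergent2E[OF assms] by blast
  have bound: "real (Suc n) * (C * R ^ i * R ^ j * R) \<le> C * R * (2 * R) ^ i * (2 * R) ^ j"
    if "n = i \<or> n = j" for n i j
  proof -
    have "(2::real) ^ n \<le> 2 ^ i * 2 ^ j"
      using that by (auto simp flip: power_add)
    then have "real (Suc n) \<le> 2 ^ i * 2 ^ j"
      using real_Suc_le_power2[of n] by linarith
    then have "real (Suc n) * (C * R ^ i * R ^ j * R) \<le> (2 ^ i * 2 ^ j) * (C * R ^ i * R ^ j * R)"
      using F by (intro mult_right_mono) auto
    then show ?thesis by (simp add: power_mult_distrib mult_ac)
  qed
  have norm_Suc: "norm (1 + of_nat n :: complex) = real (Suc n)" for n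
    by (metis norm_of_nat of_nat_Suc)
  show "convergent2 (fps2_deriv_x F)"
  proof (rule convergent2I[of "2 * R" _ "C * R"])
    fix i j
    have "norm (fps2_deriv_x F $ j $ i) = real (Suc i) * norm (F $ j $ Suc i)"
      by (simp add: fps2_deriv_x_def norm_mult norm_Suc)
    also have "\<dots> \<le> real (Suc i) * (C * R ^ i * R ^ j * R)"
      using F(3)[where i = "Suc i" and j = j] by (intro mult_left_mono) (auto simp: mult_ac)
    also note bound[of i i j]
    finally show "norm (fps2_deriv_x F $ j $ i) \<le> C * R * (2 * R) ^ i * (2 * R) ^ j" by simp
  qed (use F in auto)
  show "convergent2 (fps2_deriv_y F)"
  proof (rule convergent2I[of "2 * R" _ "C * R"])
    fix i j
    have "fps2_deriv_y F $ j $ i = of_nat (Suc j) * F $ Suc j $ i"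
      unfolding fps2_deriv_y_def fps_deriv_nth fps_of_nat[symmetric] Suc_eq_plus1[symmetric]
      by (simp only: fps_mult_left_const_nth)
    then have "norm (fps2_deriv_y F $ j $ i) = real (Suc j) * norm (F $ Suc j $ i)"
      by (simp add: norm_mult norm_Suc)
    also have "\<dots> \<le> real (Suc j) * (C * R ^ i * R ^ j * R)"
      using F(3)[where i = i and j = "Suc j"] by (intro mult_left_mono) (auto simp: mult_ac)
    also note bound[of j i j]
    finally show "norm (fps2_deriv_y F $ j $ i) \<le> C * R * (2 * R) ^ i * (2 * R) ^ j" by simp
  qed (use F in auto)
qed

typedef germ2 = "{F. convergent2 F}"
  morphisms series_of Germ
  using convergent2_const by blast

setup_lifting type_definition_germ2

instantiation germ2 :: comm_ring_1
begin

lift_definition zero_germ2 :: germ2 is 0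
  using convergent2_const[of 0] by simp

lift_definition one_germ2 :: germ2 is 1
  using convergent2_const[of 1] by simp

lift_definition plus_germ2 :: "germ2 \<Rightarrow> germ2 \<Rightarrow> germ2" is "(+)"
  by (rule convergent2_add)

lift_definition uminus_germ2 :: "germ2 \<Rightarrow> germ2" is uminus
  by (rule convergent2_uminus)

lift_definition minus_germ2 :: "germ2 \<Rightarrow> germ2 \<Rightarrow> germ2" is "(-)"
  by (metis convergent2_add convergent2_uminus diff_conv_add_uminus)

lift_definition times_germ2 :: "germ2 \<Rightarrow> germ2 \<Rightarrow> germ2" is "(*)"
  by (rule convergent2_mult)

instance
  by standard (transfer; simp add: algebra_simps)+

end

instance germ2 :: idom
  by standard (transfer; simp)

text \<open>
  The operation \<open>div\<close> is only there to make the divisibility notions of the library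
  (\<open>coprime\<close>, \<open>is_unit\<close>) available: exact quotient if it exists, \<open>0\<close> otherwise.
\<close>

instantiation germ2 :: idom_divide
begin

definition divide_germ2 :: "germ2 \<Rightarrow> germ2 \<Rightarrow> germ2" where
  "divide_germ2 a b = (if b \<noteq> 0 \<and> b dvd a then (THE c. a = c * b) else 0)"

instance
  by standard (auto simp: divide_germ2_def)

end

instance germ2 :: algebraic_semidom ..

lift_definition dx :: "germ2 \<Rightarrow> germ2" is fps2_deriv_x
  by (rule convergent2_deriv)

lift_definition dy :: "germ2 \<Rightarrow> germ2" is fps2_deriv_y
  by (rule convergent2_deriv)

lift_definition const :: "complex \<Rightarrow> germ2" is "\<lambda>c. fps_const (fps_const c)"
  by (rule convergent2_const)

definition cscale :: "complex \<Rightarrow> germ2 \<Rightarrow> germ2" where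
  "cscale c F = const c * F"

lemma const_simps:
  "const (a + b) = const a + const b" "const (a * b) = const a * const b" "const 1 = 1"
  by (transfer; simp)+


section \<open>Dimension of a quotient space, ideals\<close>

text \<open>
  \<open>basis_modulo W B\<close>: the cosets of the elements of the finite set \<open>B\<close> are pairwise distinct
  and form a basis of the quotient of the whole space by the subspace \<open>W\<close>.
\<close>

definition (in vector_space) basis_modulo :: "'b set \<Rightarrow> 'b set \<Rightarrow> bool" where
  "basis_modulo W B \<longleftrightarrow> finite B \<and>
     (\<forall>u. (\<Sum>b\<in>B. scale (u b) b) \<in> W \<longrightarrow> (\<forall>b\<in>B. u b = 0)) \<and>
     (\<forall>v. \<exists>u. v - (\<Sum>b\<in>B. scale (u b) b) \<in> W)"

definition (in vector_space) quot_dim :: "'b set \<Rightarrow> enat" where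
  "quot_dim W = (if \<exists>B. basis_modulo W B then enat (card (SOME B. basis_modulo W B)) else \<infinity>)"

global_interpretation germ: vector_space cscale
  by standard (simp_all add: cscale_def const_simps algebra_simps)

text \<open>Ideals are the submodules of the ring over itself; \<open>ideal.span S\<close> is the ideal
  generated by \<open>S\<close>.\<close>

global_interpretation ideal: module "(*) :: germ2 \<Rightarrow> germ2 \<Rightarrow> germ2"
  by standard (simp_all add: algebra_simps)

definition ideal_prod :: "germ2 set \<Rightarrow> germ2 set \<Rightarrow> germ2 set" where
  "ideal_prod I J = ideal.span {a * b | a b. a \<in> I \<and> b \<in> J}"

definition ideal_sum :: "germ2 set \<Rightarrow> germ2 set \<Rightarrow> germ2 set" where
  "ideal_sum I J = {a + b | a b. a \<in> I \<and> b \<in> J}"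

definition max_ideal :: "germ2 set" where
  "max_ideal = {F. series_of F $ 0 $ 0 = 0}"

primrec max_ideal_power :: "nat \<Rightarrow> germ2 set" where
  "max_ideal_power 0 = UNIV"
| "max_ideal_power (Suc k) = ideal_prod max_ideal (max_ideal_power k)"

definition inter_mult :: "germ2 \<Rightarrow> germ2 \<Rightarrow> enat" where
  "inter_mult a b = germ.quot_dim (ideal.span {a, b})"


section \<open>Foliations, separatrices and indices\<close>

text \<open>A holomorphic 1-form \<open>P dx + Q dy\<close> is the pair \<open>(P, Q)\<close>; a 2-form \<open>h dx \<and> dy\<close> is its
  coefficient \<open>h\<close>.\<close>

type_synonym one_form = "germ2 \<times> germ2"

definition form_scale :: "germ2 \<Rightarrow> one_form \<Rightarrow> one_form" where
  "form_scale g \<omega> = (g * fst \<omega>, g * snd \<omega>)"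

definition wedge :: "one_form \<Rightarrow> one_form \<Rightarrow> germ2" where
  "wedge \<omega> \<eta> = fst \<omega> * snd \<eta> - snd \<omega> * fst \<eta>"

definition differential :: "germ2 \<Rightarrow> one_form" where
  "differential f = (dx f, dy f)"

definition singular_foliation :: "one_form \<Rightarrow> bool" where
  "singular_foliation \<omega> \<longleftrightarrow> fst \<omega> \<in> max_ideal \<and> snd \<omega> \<in> max_ideal \<and> coprime (fst \<omega>) (snd \<omega>)"

definition invariant_curve :: "one_form \<Rightarrow> germ2 \<Rightarrow> bool" where
  "invariant_curve \<omega> f \<longleftrightarrow> (\<exists>h. wedge \<omega> (differential f) = f * h)"

definition separatrix :: "one_form \<Rightarrow> germ2 \<Rightarrow> bool" where
  "separatrix \<omega> p \<longleftrightarrow> irreducible p \<and> invariant_curve \<omega> p"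

text \<open>Equations of a finite union of curves multiply, and an equation of a curve is determined
  only up to a unit.\<close>

definition reduced_curve_of_separatrices :: "one_form \<Rightarrow> germ2 \<Rightarrow> bool" where
  "reduced_curve_of_separatrices \<omega> f \<longleftrightarrow> squarefree f \<and>
     (\<exists>A u. finite A \<and> A \<noteq> {} \<and> (\<forall>p\<in>A. separatrix \<omega> p) \<and> is_unit u \<and> f = u * \<Prod>A)"

definition tau_foliation :: "nat \<Rightarrow> one_form \<Rightarrow> germ2 \<Rightarrow> enat" where
  "tau_foliation k \<omega> f = germ.quot_dim
     (ideal_sum (ideal_prod (ideal.span {fst \<omega>, snd \<omega>}) (max_ideal_power k)) (ideal.span {f}))"

definition tau_curve :: "nat \<Rightarrow> germ2 \<Rightarrow> enat" where
  "tau_curve k f = germ.quot_dim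
     (ideal_sum (ideal_prod (ideal.span {dx f, dy f}) (max_ideal_power k)) (ideal.span {f}))"

definition GSV :: "one_form \<Rightarrow> germ2 \<Rightarrow> int" where
  "GSV \<omega> f = (THE n. \<exists>g h \<eta>. coprime g f \<and> coprime h f \<and>
     form_scale g \<omega> = form_scale h (differential f) + form_scale f \<eta> \<and>
     n = int (the_enat (inter_mult f h)) - int (the_enat (inter_mult f g)))"

end

(*
  Modulo f, the relation g \<omega> = h df + f \<eta> says that g times the ideal of \<omega> equals h times the
  ideal of df, and this remains true after multiplication with a power of the maximal ideal.
  As g and h are non-zero-divisors modulo f, both sides have colength
  i(f,g) + \<tau>^k(F,C) = i(f,h) + \<tau>^k(C). In particular the index does not depend on g and h, and such
  g, h exist: g = f_x + t f_y and h = P + t Q for a generic constant t.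

  All colengths are finite because an ideal I of O_2 without a common non-unit divisor contains a
  power of y: its saturation with respect to y is principal by Weierstrass division. The same
  fact shows that irreducible germs are prime.
*)

theory Submission
  imports Defs "HOL-Analysis.FPS_Convergence"
begin

text \<open>Division in x by c requires c(x,0) to be nonzero, that is, y must not divide c. No
  change of coordinates is made to reach this; powers of y are split off instead. Hence the
  saturation with respect to y, and hence the special role of y, the one element whose primality is
  visible on coefficients. For the chosen g and h, the germs g P - h f_x and g Q - h f_y are t and
  -1 times P f_y - Q f_x, which invariance makes a multiple of f. A branch p rules out at most one t
  for each of g and h, because p divides neither both of f_x, f_y (f is squarefree) nor both of P, Q
  (they are coprime). Colengths are cardinalities of arbitrarily chosen bases, and
  \<open>the_enat\<close> is meaningful only on finite values. So finiteness and independence of the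
  basis come before any subtraction, and the count is made with explicit bases.\<close>

unbundle no vec_syntax

text \<open>This rule associates products to the left and makes the simplifier loop with
  \<open>mult_ac\<close>.\<close>

declare ideal.scale_scale [simp del]

section \<open>Bases modulo a subspace\<close>

context vector_space
begin

text \<open>A generating set modulo W of least cardinality is independent modulo W, since an element
  occurring in a relation could be dropped.\<close>

lemma ex_basis_modulo:
  assumes W: "subspace W" and "finite B" "\<And>v. \<exists>w \<in> span B. v - w \<in> W"
  shows "\<exists>C. basis_modulo W C"
proof -
  define P where "P = (\<lambda>B. finite B \<and> (\<forall>v. \<exists>w \<in> span B. v - w \<in> W))"
  have "P B" using assms by (auto simp: P_def)
  then obtain C where C: "P C" and least: "\<And>D. P D \<Longrightarrow> card C \<le> card D"
    using ex_has_least_nat[of P B card] by blast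
  have fin: "finite C" using C by (simp add: P_def)
  have "u b = 0" if u: "(\<Sum>c\<in>C. u c *s c) \<in> W" and b: "b \<in> C" for u b
  proof (rule ccontr)
    assume ub: "u b \<noteq> 0"
    \<comment> \<open>The relation solved for \<open>b\<close>: modulo W, \<open>b\<close> equals
      \<open>t\<close>, a combination of the other elements.\<close>
    define t where "t = - (\<Sum>c\<in>C - {b}. (u c / u b) *s c)"
    have t: "t \<in> span (C - {b})"
      unfolding t_def by (intro span_neg span_sum span_scale span_base)
    have "b - t = (1 / u b) *s (\<Sum>c\<in>C. u c *s c)"
      using ub by (simp add: t_def sum.remove[OF fin b] scale_right_distrib scale_sum_right)
    then have bt: "b - t \<in> W" using u W by (simp add: subspace_scale)
    have "\<exists>w' \<in> span (C - {b}). v - w' \<in> W" for v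
    proof -
      obtain w where w: "w \<in> span C" "v - w \<in> W" using C by (auto simp: P_def)
      then obtain k where k: "w - k *s b \<in> span (C - {b})"
        using span_breakdown[OF b] by blast
      have span: "w - k *s b + k *s t \<in> span (C - {b})"
        using k t by (intro span_add span_scale)
      have eq: "v - (w - k *s b + k *s t) = (v - w) + k *s (b - t)"
        by (simp add: scale_right_diff_distrib)
      have "v - (w - k *s b + k *s t) \<in> W"
        unfolding eq by (rule subspace_add[OF W w(2) subspace_scale[OF W bt]])
      with span show ?thesis by blast
    qed
    then have "P (C - {b})" using fin by (simp add: P_def)
    from least[OF this] show False using card_Diff1_less[OF fin b] by simp
  qed
  moreover have "\<exists>u. v - (\<Sum>b\<in>C. u b *s b) \<in> W" for v
    using C fin by (auto simp: P_def span_finite)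
  ultimately show ?thesis using fin unfolding basis_modulo_def by blast
qed

text \<open>The exchange argument without forming the quotient space: each vector of C is replaced
  by a representative in the span of B. The map \<open>\<phi>\<close> need not be linear; since v -
  \<open>\<phi>\<close> v lies in W, a relation between images is a relation modulo W between the
  elements of C.\<close>

lemma basis_modulo_card_le:
  assumes W: "subspace W" and B: "basis_modulo W B" and C: "basis_modulo W C"
  shows "card C \<le> card B"
proof -
  have finB: "finite B" and finC: "finite C" using B C by (auto simp: basis_modulo_def)
  have indep: "\<forall>c\<in>C. u c = 0" if "(\<Sum>c\<in>C. u c *s c) \<in> W" for u
    using C that by (auto simp: basis_modulo_def)
  obtain m where m: "\<And>v. v - (\<Sum>b\<in>B. m v b *s b) \<in> W"
    using B unfolding basis_modulo_def by metis
  define \<phi> where "\<phi> v = (\<Sum>b\<in>B. m v b *s b)" for v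
  have *: "\<forall>c\<in>C. u c = 0" if "(\<Sum>c\<in>C. u c *s \<phi> c) = 0" for u
  proof (rule indep)
    have "(\<Sum>c\<in>C. u c *s c) = (\<Sum>c\<in>C. u c *s (c - \<phi> c))"
      using that by (simp add: scale_right_diff_distrib sum_subtractf)
    also have "\<dots> \<in> W"
      unfolding \<phi>_def by (intro subspace_sum[OF W] subspace_scale[OF W] m)
    finally show "(\<Sum>c\<in>C. u c *s c) \<in> W" .
  qed
  have inj: "inj_on \<phi> C"
  proof (rule inj_onI, rule ccontr)
    fix x y assume xy: "x \<in> C" "y \<in> C" "\<phi> x = \<phi> y" "x \<noteq> y"
    define u where "u c = (if c = x then 1 else if c = y then -1 else 0 :: 'a)" for c
    have "(\<Sum>c\<in>C. u c *s \<phi> c) = (\<Sum>c\<in>{x, y}. u c *s \<phi> c)"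
      using xy finC by (intro sum.mono_neutral_right) (auto simp: u_def)
    also have "\<dots> = 0" using xy by (simp add: u_def)
    finally have "u x = 0" using * xy(1) by blast
    then show False by (simp add: u_def)
  qed
  have "independent (\<phi> ` C)"
  proof (rule independent_if_scalars_zero)
    show "finite (\<phi> ` C)" using finC by simp
    fix u x assume "(\<Sum>x\<in>\<phi> ` C. u x *s x) = 0" "x \<in> \<phi> ` C"
    then show "u x = 0"
      using *[of "u \<circ> \<phi>"] inj by (auto simp: sum.reindex)
  qed
  moreover have "\<phi> ` C \<subseteq> span B"
    unfolding \<phi>_def by (intro image_subsetI span_sum span_scale span_base)
  ultimately have "card (\<phi> ` C) \<le> card B"
    using independent_span_bound[OF finB] by blast
  then show ?thesis using inj by (simp add: card_image)
qed

text \<open>\<open>quot_dim\<close> evaluates an arbitrary choice of basis; comparing cardinalities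
  in both directions makes the choice harmless.\<close>

lemma quot_dim_eq_card:
  assumes "subspace W" "basis_modulo W B"
  shows "quot_dim W = enat (card B)"
proof -
  have "basis_modulo W (SOME B. basis_modulo W B)" using assms(2) by (rule someI)
  then show ?thesis
    using assms basis_modulo_card_le unfolding quot_dim_def by (auto intro: antisym)
qed

lemma basis_modulo_iff_span:
  "basis_modulo W B \<longleftrightarrow> finite B \<and>
     (\<forall>u. (\<Sum>b\<in>B. u b *s b) \<in> W \<longrightarrow> (\<forall>b\<in>B. u b = 0)) \<and> (\<forall>v. \<exists>w \<in> span B. v - w \<in> W)"
  unfolding basis_modulo_def by (auto simp: span_finite)

lemma basis_modulo_not_mem:
  assumes "basis_modulo W B" "b \<in> B"
  shows "b \<notin> W"
proof
  assume "b \<in> W"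
  define u where "u c = (if c = b then 1 else 0 :: 'a)" for c
  have "finite B" using assms(1) by (simp add: basis_modulo_def)
  then have "(\<Sum>c\<in>B. u c *s c) = (\<Sum>c\<in>{b}. u c *s c)"
    using assms(2) by (intro sum.mono_neutral_right) (auto simp: u_def)
  then have "(\<Sum>c\<in>B. u c *s c) \<in> W" using \<open>b \<in> W\<close> by (simp add: u_def)
  then have "u b = 0" using assms by (simp add: basis_modulo_def)
  then show False by (simp add: u_def)
qed

lemma basis_modulo_diff_not_mem:
  assumes "basis_modulo W B" "b \<in> B" "c \<in> B" "b \<noteq> c"
  shows "b - c \<notin> W"
proof
  assume "b - c \<in> W"
  define u where "u x = (if x = b then 1 else if x = c then - 1 else 0 :: 'a)" for x
  have "finite B" using assms(1) by (simp add: basis_modulo_def)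
  then have "(\<Sum>x\<in>B. u x *s x) = (\<Sum>x\<in>{b, c}. u x *s x)"
    using assms by (intro sum.mono_neutral_right) (auto simp: u_def)
  then have "(\<Sum>x\<in>B. u x *s x) \<in> W" using \<open>b - c \<in> W\<close> assms(4) by (simp add: u_def)
  then have "u b = 0" using assms by (simp add: basis_modulo_def)
  then show False by (simp add: u_def)
qed

end

section \<open>Weierstrass division of convergent series\<close>

text \<open>The l^1 norm with weights s^i is at most A. Bounding partial sums avoids carrying
  summability through the recursion for the quotient; this norm is chosen because it is
  submultiplicative.\<close>

definition weight_bound :: "real \<Rightarrow> real \<Rightarrow> complex fps \<Rightarrow> bool" where
  "weight_bound s A F \<longleftrightarrow> (\<forall>n. (\<Sum>i<n. norm (F $ i) * s ^ i) \<le> A)"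

lemma weight_boundD: "weight_bound s A F \<Longrightarrow> (\<Sum>i<n. norm (F $ i) * s ^ i) \<le> A"
  by (simp add: weight_bound_def)

lemma weight_bound_nonneg: "weight_bound s A F \<Longrightarrow> 0 \<le> A"
  using weight_boundD[of s A F 0] by simp

lemma weight_bound_mono: "weight_bound s A F \<Longrightarrow> A \<le> B \<Longrightarrow> weight_bound s B F"
  unfolding weight_bound_def by (meson order_trans)

lemma weight_bound_smaller_radius:
  assumes "weight_bound s A F" "0 \<le> t" "t \<le> s"
  shows "weight_bound t A F"
  unfolding weight_bound_def
proof
  fix n
  have "(\<Sum>i<n. norm (F $ i) * t ^ i) \<le> (\<Sum>i<n. norm (F $ i) * s ^ i)"
    using assms by (intro sum_mono mult_left_mono power_mono) auto
  then show "(\<Sum>i<n. norm (F $ i) * t ^ i) \<le> A"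
    using weight_boundD[OF assms(1)] order_trans by blast
qed

lemma weight_bound_coeff:
  assumes "weight_bound s A F" "s > 0"
  shows "norm (F $ i) * s ^ i \<le> A"
proof -
  have "norm (F $ i) * s ^ i \<le> (\<Sum>l<Suc i. norm (F $ l) * s ^ l)"
    using assms by (simp add: sum_nonneg)
  then show ?thesis using weight_boundD[OF assms(1)] order_trans by blast
qed

lemma weight_bound_0: "weight_bound s 0 0"
  by (simp add: weight_bound_def)

lemma weight_bound_diff:
  assumes "weight_bound s A F" "weight_bound s B G" "s > 0"
  shows "weight_bound s (A + B) (F - G)"
  unfolding weight_bound_def
proof
  fix n
  have "(\<Sum>i<n. norm ((F - G) $ i) * s ^ i) \<le> (\<Sum>i<n. (norm (F $ i) + norm (G $ i)) * s ^ i)"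
    using assms by (intro sum_mono mult_right_mono) (auto simp: norm_triangle_ineq4)
  also have "\<dots> \<le> A + B"
    using weight_boundD[OF assms(1), of n] weight_boundD[OF assms(2), of n]
    by (simp add: distrib_right sum.distrib)
  finally show "(\<Sum>i<n. norm ((F - G) $ i) * s ^ i) \<le> A + B" .
qed

lemma weight_bound_add:
  assumes "weight_bound s A F" "weight_bound s B G" "s > 0"
  shows "weight_bound s (A + B) (F + G)"
proof -
  have "weight_bound s B (- G)" using assms(2) by (simp add: weight_bound_def)
  from weight_bound_diff[OF assms(1) this assms(3)] show ?thesis by simp
qed

lemma weight_bound_sum:
  assumes "finite I" "\<And>i. i \<in> I \<Longrightarrow> weight_bound s (A i) (F i)" "s > 0"
  shows "weight_bound s (sum A I) (sum F I)"
  using assms by (induction I rule: finite_induct) (auto intro: weight_bound_0 weight_bound_add)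

text \<open>The terms of the first n coefficients of the product form a triangle inside the square
  of index pairs below n, and the sum over the square is a product of two partial sums.\<close>

lemma weight_bound_mult:
  assumes "weight_bound s A F" "weight_bound s B G" "s > 0"
  shows "weight_bound s (A * B) (F * G)"
  unfolding weight_bound_def
proof
  fix n
  define \<phi> where "\<phi> = (\<lambda>(a, b). norm (F $ a) * s ^ a * (norm (G $ b) * s ^ b))"
  have nn: "\<phi> p \<ge> 0" for p using assms(3) by (auto simp: \<phi>_def split: prod.splits)
  have "(\<Sum>i<n. norm ((F * G) $ i) * s ^ i) \<le> (\<Sum>i<n. \<Sum>a=0..i. \<phi> (a, i - a))"
  proof (rule sum_mono)
    fix i
    have "norm ((F * G) $ i) * s ^ i \<le> (\<Sum>a=0..i. norm (F $ a * G $ (i - a))) * s ^ i"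
      using assms(3) by (intro mult_right_mono) (auto simp: fps_mult_nth intro: norm_sum)
    also have "\<dots> = (\<Sum>a=0..i. \<phi> (a, i - a))"
      unfolding sum_distrib_right \<phi>_def
    proof (rule sum.cong[OF refl])
      fix a assume "a \<in> {0..i}"
      then have "s ^ i = s ^ a * s ^ (i - a)" by (simp flip: power_add)
      then show "norm (F $ a * G $ (i - a)) * s ^ i = (case (a, i - a) of (a, b) \<Rightarrow>
          norm (F $ a) * s ^ a * (norm (G $ b) * s ^ b))"
        by (simp add: norm_mult)
    qed
    finally show "norm ((F * G) $ i) * s ^ i \<le> (\<Sum>a=0..i. \<phi> (a, i - a))" .
  qed
  also have "\<dots> = (\<Sum>(i, a) \<in> (SIGMA i:{..<n}. {0..i}). \<phi> (a, i - a))"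
    by (rule sum.Sigma) auto
  also have "\<dots> = sum \<phi> ((\<lambda>(i, a). (a, i - a)) ` (SIGMA i:{..<n}. {0..i}))"
    by (subst sum.reindex) (auto simp: inj_on_def case_prod_unfold)
  also have "\<dots> \<le> sum \<phi> ({..<n} \<times> {..<n})"
    using nn by (intro sum_mono2) auto
  also have "\<dots> = (\<Sum>a<n. norm (F $ a) * s ^ a) * (\<Sum>b<n. norm (G $ b) * s ^ b)"
    by (simp add: \<phi>_def sum_product sum.cartesian_product)
  also have "\<dots> \<le> A * B"
    using assms weight_bound_nonneg by (intro mult_mono weight_boundD sum_nonneg) auto
  finally show "(\<Sum>i<n. norm ((F * G) $ i) * s ^ i) \<le> A * B" .
qed

lemma weight_bound_shift:
  assumes "weight_bound s A F" "s > 0"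
  shows "weight_bound s (A / s ^ d) (fps_shift d F)"
  unfolding weight_bound_def
proof
  fix n
  have "(\<Sum>i<n. norm (fps_shift d F $ i) * s ^ i) * s ^ d
      = (\<Sum>i<n. norm (F $ (i + d)) * s ^ (i + d))"
    by (simp add: sum_distrib_right power_add mult.assoc)
  also have "\<dots> = (\<Sum>i\<in>{d..<n + d}. norm (F $ i) * s ^ i)"
    using sum.shift_bounds_nat_ivl[of "\<lambda>i. norm (F $ i) * s ^ i" 0 d n]
    by (simp add: lessThan_atLeast0)
  also have "\<dots> \<le> (\<Sum>i<n + d. norm (F $ i) * s ^ i)"
    using assms(2) by (intro sum_mono2) auto
  also have "\<dots> \<le> A" using assms(1) by (rule weight_boundD)
  finally show "(\<Sum>i<n. norm (fps_shift d F $ i) * s ^ i) \<le> A / s ^ d"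
    using assms(2) by (simp add: field_simps)
qed

text \<open>Together with the passage back in the next lemma, this gives access to the convergence
  of the inverse of a series in one variable, needed for the unit factor of the divisor's
  coefficient at y^0.\<close>

lemma fps_conv_radius_pos_if_weight_bound:
  assumes "weight_bound s A F" "s > 0"
  shows "fps_conv_radius F > 0"
proof -
  have "summable (\<lambda>i. norm (F $ i * of_real s ^ i))"
  proof (rule summableI_nonneg_bounded)
    show "(\<Sum>i<n. norm (F $ i * of_real s ^ i)) \<le> A" for n
      using weight_boundD[OF assms(1), of n] assms(2) by (simp add: norm_mult norm_power)
  qed simp
  then have "summable (\<lambda>i. F $ i * of_real s ^ i)" by (rule summable_norm_cancel)
  from conv_radius_geI[OF this] show ?thesis
    using assms(2) unfolding fps_conv_radius_def
    by (metis abs_of_pos ereal_less(2) less_le_trans norm_of_real)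
qed

lemma weight_bound_if_fps_conv_radius_pos:
  assumes "fps_conv_radius F > 0"
  obtains s A where "s > 0" "weight_bound s A F"
proof -
  obtain s where s: "s > 0" "ereal s < fps_conv_radius F"
    using ereal_dense2[OF assms] by (auto simp: zero_ereal_def)
  have "summable (\<lambda>i. norm (F $ i * of_real s ^ i))"
    using s by (intro abs_summable_in_conv_radius) (auto simp: fps_conv_radius_def)
  then have sm: "summable (\<lambda>i. norm (F $ i) * s ^ i)"
    using s(1) by (simp add: norm_mult norm_power)
  have "weight_bound s (\<Sum>i. norm (F $ i) * s ^ i) F"
    unfolding weight_bound_def using s(1) by (intro allI sum_le_suminf[OF sm]) auto
  with s(1) show ?thesis using that by blast
qed

section \<open>Convergence in two variables as geometric growth of the coefficients of y^j\<close>

lemma convergent2_imp_weight_bound: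
  assumes "convergent2 F"
  obtains C R s where "C \<ge> 0" "R \<ge> 1" "s > 0" "\<And>j. weight_bound s (C * R ^ j) (F $ j)"
proof -
  obtain C R where F: "C \<ge> 0" "R \<ge> 1" "\<And>i j. norm (F $ j $ i) \<le> C * R ^ i * R ^ j"
    using convergent2E[OF assms] by blast
  \<comment> \<open>With this weight R^i s^i is 2^-i, so one weight serves all powers of y and the
    sums cost only a factor 2.\<close>
  define s where "s = 1 / (2 * R)"
  have s: "s > 0" "R * s = 1/2" using F by (auto simp: s_def)
  have "weight_bound s (2 * C * R ^ j) (F $ j)" for j
    unfolding weight_bound_def
  proof
    fix n
    have "(\<Sum>i<n. norm (F $ j $ i) * s ^ i) \<le> (\<Sum>i<n. C * R ^ i * R ^ j * s ^ i)"
      using F s by (intro sum_mono mult_right_mono) auto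
    also have "\<dots> = (\<Sum>i<n. (1/2) ^ i) * (C * R ^ j)"
      unfolding sum_distrib_right s(2)[symmetric] by (simp add: power_mult_distrib mult_ac)
    also have "\<dots> \<le> 2 * (C * R ^ j)"
    proof (rule mult_right_mono)
      have "(\<Sum>i<n. (1/2::real) ^ i) \<le> (\<Sum>i. (1/2) ^ i)"
        by (rule sum_le_suminf) (auto intro: summable_geometric)
      then show "(\<Sum>i<n. (1/2::real) ^ i) \<le> 2" by (simp add: suminf_geometric)
    qed (use F in auto)
    finally show "(\<Sum>i<n. norm (F $ j $ i) * s ^ i) \<le> 2 * C * R ^ j" by simp
  qed
  then show ?thesis using that[of "2 * C" R s] F s by auto
qed

lemma weight_bound_imp_convergent2:
  assumes "s > 0" "R > 0" "\<And>j. weight_bound s (C * R ^ j) (F $ j)"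
  shows "convergent2 F"
proof (rule convergent2I)
  define T where "T = max R (1 / s)"
  show "T > 0" using assms by (simp add: T_def)
  have C: "C \<ge> 0" using weight_bound_nonneg[OF assms(3)[of 0]] by simp
  fix i j
  have "norm (F $ j $ i) \<le> C * R ^ j * (1 / s) ^ i"
    using weight_bound_coeff[OF assms(3)[of j] assms(1), of i] assms(1)
    by (simp add: field_simps power_one_over)
  also have "\<dots> \<le> C * T ^ j * T ^ i"
    using assms C by (intro mult_mono power_mono) (auto simp: T_def)
  finally show "norm (F $ j $ i) \<le> C * T ^ i * T ^ j" by (simp add: mult_ac)
qed

text \<open>The coefficients of the quotient \<open>Q\<close> are found by requiring, one power of \<open>y\<close> after the other,
  that \<open>Z - Q F\<close> has no terms of degree at least \<open>d\<close> in \<open>x\<close>.\<close>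

function division_coeff :: "complex fps fps \<Rightarrow> complex fps fps \<Rightarrow> nat \<Rightarrow> complex fps" where
  "division_coeff Z F j = (let d = subdegree (F $ 0) in
     fps_shift d (Z $ j - (\<Sum>l<j. division_coeff Z F l * F $ (j - l)))
       * inverse (fps_shift d (F $ 0)))"
  by pat_completeness auto
termination
  by (relation "measure (\<lambda>(Z, F, j). j)") auto

declare division_coeff.simps [simp del]

text \<open>For M large against R, the convolution is only the fraction 2R/M of M^j. This lets a
  geometric bound pass through the recursion for the quotient.\<close>

lemma geometric_convolution_le:
  fixes R M :: real
  assumes "0 \<le> R" "2 * R \<le> M"
  shows "M * (\<Sum>l<j. M ^ l * R ^ (j - l)) \<le> 2 * R * M ^ j"
proof (induction j)
  case 0
  then show ?case using assms by simp
next
  case (Suc j)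
  have "(\<Sum>l<Suc j. M ^ l * R ^ (Suc j - l)) = R * ((\<Sum>l<j. M ^ l * R ^ (j - l)) + M ^ j)"
    by (simp add: sum_distrib_left Suc_diff_le distrib_left mult_ac)
  then have "M * (\<Sum>l<Suc j. M ^ l * R ^ (Suc j - l))
      = R * (M * (\<Sum>l<j. M ^ l * R ^ (j - l)) + M * M ^ j)"
    by (simp add: algebra_simps)
  also have "\<dots> \<le> R * (2 * R * M ^ j + M * M ^ j)"
    using assms by (intro mult_left_mono add_right_mono Suc.IH) auto
  also have "\<dots> \<le> R * (M * M ^ j + M * M ^ j)"
    using assms by (intro mult_left_mono add_right_mono mult_right_mono) auto
  finally show ?case by (simp add: algebra_simps)
qed

lemma convergent2_division_coeff:
  assumes "convergent2 F" "F $ 0 \<noteq> 0" "convergent2 Z"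
  shows "convergent2 (Abs_fps (division_coeff Z F))"
proof -
  define d where "d = subdegree (F $ 0)"
  define v where "v = fps_shift d (F $ 0)"
  obtain C1 R1 s1 where F: "C1 \<ge> 0" "R1 \<ge> 1" "s1 > 0" "\<And>j. weight_bound s1 (C1 * R1 ^ j) (F $ j)"
    using convergent2_imp_weight_bound[OF assms(1)] by blast
  obtain C2 R2 s2 where Z: "C2 \<ge> 0" "R2 \<ge> 1" "s2 > 0" "\<And>j. weight_bound s2 (C2 * R2 ^ j) (Z $ j)"
    using convergent2_imp_weight_bound[OF assms(3)] by blast
  have v0: "v $ 0 \<noteq> 0" using assms(2) by (simp add: v_def d_def)
  have "fps_conv_radius v > 0"
    unfolding v_def
    by (rule fps_conv_radius_pos_if_weight_bound[OF weight_bound_shift[OF F(4)[of 0] F(3)] F(3)])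
  from fps_conv_radius_inverse_pos[OF v0 this]
  obtain s3 E where v: "s3 > 0" "weight_bound s3 E (inverse v)"
    by (rule weight_bound_if_fps_conv_radius_pos)
  define s where "s = min s1 (min s2 s3)"
  have s: "s > 0" using F Z v by (simp add: s_def)
  have bF: "weight_bound s (C1 * R1 ^ j) (F $ j)" for j
    using F s by (intro weight_bound_smaller_radius[OF F(4)]) (auto simp: s_def)
  have bZ: "weight_bound s (C2 * R2 ^ j) (Z $ j)" for j
    using F s by (intro weight_bound_smaller_radius[OF Z(4)]) (auto simp: s_def)
  have bv: "weight_bound s E (inverse v)"
    using F s by (intro weight_bound_smaller_radius[OF v(2)]) (auto simp: s_def)
  have E: "E \<ge> 0" using weight_bound_nonneg[OF v(2)] .
  \<comment> \<open>The cost of dropping the first d coefficients and multiplying by the inverse of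
    v.\<close>
  define D where "D = E / s ^ d"
  have D: "D \<ge> 0" using E s by (simp add: D_def)
  \<comment> \<open>The claim will be the bound K M^j. By the choice of K, the contribution of Z is
    at most half of it; M >= 4 D C1 R1 achieves the same for the earlier coefficients, M >= R2
    compares the growth of Z, and M >= 2 R1 permits the convolution estimate.\<close>
  define K where "K = 2 * D * C2"
  define M where "M = max (max R2 (2 * R1)) (4 * D * C1 * R1)"
  have M: "M \<ge> R2" "M \<ge> 2 * R1" "M \<ge> 4 * D * C1 * R1" by (auto simp: M_def)
  then have M0: "M > 0" using Z by linarith
  have K: "K \<ge> 0" using D Z by (simp add: K_def)
  have "weight_bound s (K * M ^ j) (division_coeff Z F j)" for j
  proof (induction j rule: less_induct)
    case (less j)
    define S where "S = (\<Sum>l<j. M ^ l * R1 ^ (j - l))"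
    have "weight_bound s (\<Sum>l<j. (K * M ^ l) * (C1 * R1 ^ (j - l)))
        (\<Sum>l<j. division_coeff Z F l * F $ (j - l))"
      using s by (intro weight_bound_sum weight_bound_mult less bF) auto
    then have "weight_bound s (K * C1 * S) (\<Sum>l<j. division_coeff Z F l * F $ (j - l))"
      by (simp add: S_def sum_distrib_left mult_ac)
    then have "weight_bound s ((C2 * R2 ^ j + K * C1 * S) / s ^ d * E) (division_coeff Z F j)"
      unfolding division_coeff.simps[of Z F j] Let_def d_def[symmetric] v_def[symmetric]
      by (intro weight_bound_mult weight_bound_shift weight_bound_diff bZ bv s)
    moreover have "(C2 * R2 ^ j + K * C1 * S) / s ^ d * E \<le> K * M ^ j"
    proof -
      have "(C2 * R2 ^ j + K * C1 * S) / s ^ d * E = D * C2 * R2 ^ j + K * (D * C1 * S)"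
        using s by (simp add: D_def add_divide_distrib distrib_left mult_ac)
      moreover have "D * C2 * R2 ^ j \<le> D * C2 * M ^ j"
        using D Z M by (intro mult_left_mono power_mono) auto
      moreover have "2 * (D * C1 * S) \<le> M ^ j"
      proof -
        have "M * (2 * (D * C1 * S)) = 2 * (D * C1) * (M * S)" by simp
        also have "\<dots> \<le> 2 * (D * C1) * (2 * R1 * M ^ j)"
          unfolding S_def using D F M by (intro mult_left_mono geometric_convolution_le) auto
        also have "\<dots> = (4 * D * C1 * R1) * M ^ j" by simp
        also have "\<dots> \<le> M * M ^ j" using M M0 by (intro mult_right_mono) auto
        finally show ?thesis using M0 by simp
      qed
      then have "K * (2 * (D * C1 * S)) \<le> K * M ^ j" using K by (rule mult_left_mono)
      ultimately show ?thesis by (simp add: K_def mult_ac)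
    qed
    ultimately show ?case by (rule weight_bound_mono)
  qed
  then show ?thesis using s M0 by (intro weight_bound_imp_convergent2[of s M K]) auto
qed

text \<open>Write F_0 = x^d v with v a unit. The coefficient of y^j is w - q_j F_0, where w is
  already determined by the earlier q_l, and q_j is such that q_j F_0 is exactly the part of w of
  degree at least d in x.\<close>

lemma division_coeff_remainder:
  assumes "F $ 0 \<noteq> 0" "i \<ge> subdegree (F $ 0)"
  shows "(Z - Abs_fps (division_coeff Z F) * F) $ j $ i = 0"
proof -
  define d where "d = subdegree (F $ 0)"
  define v where "v = fps_shift d (F $ 0)"
  define q where "q = division_coeff Z F"
  define w where "w = Z $ j - (\<Sum>l<j. q l * F $ (j - l))"
  have v0: "v $ 0 \<noteq> 0" using assms(1) by (simp add: v_def d_def)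
  have qj: "q j = fps_shift d w * inverse v"
    unfolding q_def division_coeff.simps[of Z F j] Let_def d_def[symmetric] v_def[symmetric]
    by (simp add: w_def q_def)
  have F0: "F $ 0 = v * fps_X ^ d"
    unfolding v_def d_def by (rule subdegree_decompose)
  have "{0..j} = insert j {..<j}" by auto
  then have "(Z - Abs_fps q * F) $ j = w - q j * F $ 0"
    by (simp add: fps_mult_nth w_def)
  also have "q j * F $ 0 = fps_shift d w * fps_X ^ d"
    unfolding qj F0 using inverse_mult_eq_1[OF v0] by (metis mult.assoc mult.right_neutral)
  finally have "(Z - Abs_fps q * F) $ j $ i = w $ i - (fps_shift d w * fps_X ^ d) $ i"
    by simp
  also have "\<dots> = 0" using assms(2) by (simp add: d_def fps_X_power_mult_right_nth)
  finally show ?thesis by (simp add: q_def)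
qed

section \<open>The ring of germs\<close>

lemma series_of_simps [simp]:
  "series_of 0 = 0" "series_of 1 = 1" "series_of (a + b) = series_of a + series_of b"
  "series_of (- a) = - series_of a" "series_of (a - b) = series_of a - series_of b"
  "series_of (a * b) = series_of a * series_of b"
  "series_of (const z) = fps_const (fps_const z)"
  by (simp_all add: zero_germ2.rep_eq one_germ2.rep_eq plus_germ2.rep_eq uminus_germ2.rep_eq
      minus_germ2.rep_eq times_germ2.rep_eq const.rep_eq)

lemma series_of_power [simp]: "series_of (a ^ n) = series_of a ^ n"
  by (induction n) simp_all

lemma series_of_sum: "series_of (sum g A) = (\<Sum>i\<in>A. series_of (g i))"
  by (induction A rule: infinite_finite_induct) simp_all

lemma series_of_eq_0_iff [simp]: "series_of a = 0 \<longleftrightarrow> a = 0"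
  by (metis series_of_inject series_of_simps(1))

lift_definition germ_x :: germ2 is "fps_const fps_X"
  by (rule convergent2I[of 1 _ 1]) (auto simp: fps_X_def)

lift_definition germ_y :: germ2 is fps_X
  by (rule convergent2I[of 1 _ 1]) (auto simp: fps_X_def)

declare germ_x.rep_eq [simp] germ_y.rep_eq [simp]

lemma convergent2_fps_shift:
  assumes "convergent2 F"
  shows "convergent2 (fps_shift m F)"
proof -
  obtain C R where F: "C \<ge> 0" "R \<ge> 1" "\<And>i j. norm (F $ j $ i) \<le> C * R ^ i * R ^ j"
    using convergent2E[OF assms] by blast
  have "norm (fps_shift m F $ j $ i) \<le> C * R ^ m * R ^ i * R ^ j" for i j
    using F(3)[where i = i and j = "j + m"] by (simp add: power_add mult_ac)
  with F(2) show ?thesis by (intro convergent2I[of R _ "C * R ^ m"]) auto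
qed

lemma germ_y_power_dvd_iff: "germ_y ^ n dvd a \<longleftrightarrow> (\<forall>j<n. series_of a $ j = 0)"
proof
  assume "germ_y ^ n dvd a"
  then show "\<forall>j<n. series_of a $ j = 0"
    by (auto elim!: dvdE simp: fps_X_power_mult_nth)
next
  assume *: "\<forall>j<n. series_of a $ j = 0"
  define b where "b = Germ (fps_shift n (series_of a))"
  have "series_of b = fps_shift n (series_of a)"
    unfolding b_def using series_of[of a] by (intro Germ_inverse) (simp add: convergent2_fps_shift)
  then have "series_of a = series_of (germ_y ^ n * b)"
    using * by (intro fps_ext) (simp add: fps_X_power_mult_nth)
  then show "germ_y ^ n dvd a" by (simp only: series_of_inject) simp
qed

lemma germ_y_dvd_iff: "germ_y dvd a \<longleftrightarrow> series_of a $ 0 = 0"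
  using germ_y_power_dvd_iff[of 1 a] by simp

text \<open>Reduction modulo y is the coefficient at y^0, with values in the integral domain of
  series in x. The primality of the other irreducible germs is deduced from this one.\<close>

lemma prime_elem_germ_y: "prime_elem germ_y"
  by (rule prime_elemI) (auto simp: germ_y_dvd_iff simp flip: series_of_eq_0_iff)

lemma not_germ_y_dvd_germ_x: "\<not> germ_y dvd germ_x"
  by (simp add: germ_y_dvd_iff)

lemma germ_y_decompose:
  assumes "a \<noteq> 0"
  obtains m b where "a = germ_y ^ m * b" "\<not> germ_y dvd b"
proof -
  define m where "m = subdegree (series_of a)"
  have "germ_y ^ m dvd a" by (auto simp: germ_y_power_dvd_iff m_def)
  then obtain b where b: "a = germ_y ^ m * b" by (elim dvdE)
  have "series_of a $ m \<noteq> 0" using assms by (simp add: m_def)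
  then have "series_of b $ 0 \<noteq> 0" by (simp add: b fps_X_power_mult_nth)
  with b that show ?thesis by (simp add: germ_y_dvd_iff)
qed

text \<open>The hypothesis says that c(x,0) is not zero, and its order bounds the degree in x of the
  remainder.\<close>

lemma weierstrass_division:
  assumes "\<not> germ_y dvd c"
  obtains q r where "z = q * c + r"
    "\<And>i j. i \<ge> subdegree (series_of c $ 0) \<Longrightarrow> series_of r $ j $ i = 0"
proof -
  have c0: "series_of c $ 0 \<noteq> 0" using assms by (simp add: germ_y_dvd_iff)
  define q where "q = Germ (Abs_fps (division_coeff (series_of z) (series_of c)))"
  have "series_of q = Abs_fps (division_coeff (series_of z) (series_of c))"
    unfolding q_def using series_of[of c] series_of[of z] c0
    by (intro Germ_inverse) (simp add: convergent2_division_coeff)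
  then have "series_of (z - q * c) $ j $ i = 0" if "i \<ge> subdegree (series_of c $ 0)" for i j
    using division_coeff_remainder[OF c0 that, of "series_of z" j] by simp
  then show ?thesis using that[of q "z - q * c"] by simp
qed

text \<open>For the converse, divide 1 by a: since a(x,0) has order 0, the remainder has no terms at
  all.\<close>

lemma is_unit_germ_iff: "is_unit a \<longleftrightarrow> series_of a $ 0 $ 0 \<noteq> 0"
proof
  assume "is_unit a"
  then obtain b where "1 = a * b" by (elim dvdE)
  then have "series_of 1 $ 0 $ 0 = (series_of a * series_of b) $ 0 $ 0"
    by (metis series_of_simps(6))
  then show "series_of a $ 0 $ 0 \<noteq> 0" by auto
next
  assume a: "series_of a $ 0 $ 0 \<noteq> 0"
  then have "\<not> germ_y dvd a" by (auto simp: germ_y_dvd_iff)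
  then obtain q r where qr: "1 = q * a + r"
    "\<And>i j. i \<ge> subdegree (series_of a $ 0) \<Longrightarrow> series_of r $ j $ i = 0"
    using weierstrass_division by blast
  have "subdegree (series_of a $ 0) = 0" using a by simp
  then have "series_of r = 0" using qr(2) by (intro fps_ext) simp
  then have "1 = a * q" using qr(1) by (simp add: mult.commute)
  then show "is_unit a" by (rule dvdI)
qed

lemma series_of_monomial:
  "series_of (cscale z (germ_x ^ i * germ_y ^ j)) $ j' $ i' = (if j' = j \<and> i' = i then z else 0)"
proof -
  have "series_of (cscale z (germ_x ^ i * germ_y ^ j))
      = fps_const (fps_const z * fps_X ^ i) * fps_X ^ j"
    by (simp add: cscale_def fps_const_power flip: mult.assoc)
  then have "series_of (cscale z (germ_x ^ i * germ_y ^ j)) $ j'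
      = (if j' = j then fps_const z * fps_X ^ i else 0)"
    by (simp only: fps_X_power_mult_right_nth fps_nth_fps_const) auto
  then show ?thesis
    by (simp only: fps_X_power_mult_right_nth fps_nth_fps_const if_distrib[of "\<lambda>F. F $ i'"]) auto
qed

lemma ideal_imp_subspace: "ideal.subspace I \<Longrightarrow> germ.subspace I"
  by (simp add: germ.subspace_def ideal.subspace_def cscale_def)

text \<open>The saturation of \<open>I\<close> with respect to \<open>y\<close> is a principal ideal: by Weierstrass division
  it is generated by any of its elements of least order in \<open>x\<close> on the line \<open>y = 0\<close>.\<close>

lemma germ_y_power_in_ideal:
  assumes I: "ideal.subspace I" and cop: "\<And>c. (\<And>a. a \<in> I \<Longrightarrow> c dvd a) \<Longrightarrow> is_unit c"
  shows "\<exists>n. germ_y ^ n \<in> I"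
proof -
  define J where "J = {z. \<exists>n. germ_y ^ n * z \<in> I}"
  have IJ: "I \<subseteq> J"
  proof
    fix a assume "a \<in> I"
    then show "a \<in> J" unfolding J_def by (intro CollectI exI[of _ 0]) simp
  qed
  have sat: "z \<in> J" if mz: "germ_y ^ m * z \<in> J" for m z
  proof -
    obtain n where "germ_y ^ n * (germ_y ^ m * z) \<in> I" using mz unfolding J_def by blast
    then have "germ_y ^ (n + m) * z \<in> I" by (simp only: power_add mult.assoc)
    then show ?thesis unfolding J_def by blast
  qed
  have diff: "z - q * c \<in> J" if zc: "z \<in> J" "c \<in> J" for z q c
  proof -
    obtain m where m: "germ_y ^ m * z \<in> I" using zc(1) by (auto simp: J_def)
    obtain n where n: "germ_y ^ n * c \<in> I" using zc(2) by (auto simp: J_def)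
    have "germ_y ^ n * (germ_y ^ m * z) - (germ_y ^ m * q) * (germ_y ^ n * c) \<in> I"
      by (rule ideal.subspace_diff[OF I ideal.subspace_scale[OF I m] ideal.subspace_scale[OF I n]])
    moreover have "germ_y ^ n * (germ_y ^ m * z) - (germ_y ^ m * q) * (germ_y ^ n * c)
        = germ_y ^ (n + m) * (z - q * c)"
      by (simp only: power_add right_diff_distrib mult_ac)
    ultimately have "germ_y ^ (n + m) * (z - q * c) \<in> I" by (simp only:)
    then show ?thesis unfolding J_def by blast
  qed
  have "\<not> is_unit germ_y" by (simp add: is_unit_germ_iff)
  then obtain a where "a \<in> I" "\<not> germ_y dvd a" using cop[of germ_y] by blast
  then have "a \<in> J \<and> \<not> germ_y dvd a" using IJ by blast
  then obtain c where c: "c \<in> J" "\<not> germ_y dvd c" and least: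
    "\<And>b. b \<in> J \<Longrightarrow> \<not> germ_y dvd b \<Longrightarrow> subdegree (series_of c $ 0) \<le> subdegree (series_of b $ 0)"
    using ex_has_least_nat[of "\<lambda>c. c \<in> J \<and> \<not> germ_y dvd c" a "\<lambda>c. subdegree (series_of c $ 0)"]
    by blast
  have "c dvd z" if z: "z \<in> J" for z
  proof -
    obtain q r where qr: "z = q * c + r"
      "\<And>i j. i \<ge> subdegree (series_of c $ 0) \<Longrightarrow> series_of r $ j $ i = 0"
      using weierstrass_division[OF c(2)] by blast
    have "r \<in> J" using diff[OF z c(1), of q] unfolding qr(1) by simp
    have r0: "r = 0"
    proof (rule ccontr)
      assume "r \<noteq> 0"
      \<comment> \<open>Saturation allows dividing \<open>r\<close> by its largest power of y. The
        quotient \<open>b\<close> stays in J, and b(x,0) is a nonzero coefficient of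
        \<open>r\<close>, hence of order below that of c(x,0), against the choice of
        \<open>c\<close>.\<close>
      then obtain m b where b: "r = germ_y ^ m * b" "\<not> germ_y dvd b" by (rule germ_y_decompose)
      have "b \<in> J" using sat[of m b] \<open>r \<in> J\<close> b(1) by simp
      have "series_of b $ 0 = series_of r $ m" by (simp add: b(1) fps_X_power_mult_nth)
      moreover have "series_of b $ 0 \<noteq> 0" using b(2) by (simp add: germ_y_dvd_iff)
      ultimately have "series_of r $ m $ subdegree (series_of b $ 0) \<noteq> 0" by auto
      with qr(2)[OF least[OF \<open>b \<in> J\<close> b(2)]] show False by simp
    qed
    show ?thesis unfolding qr(1) r0 by simp
  qed
  \<comment> \<open>As a generator of J, \<open>c\<close> divides all of I and so is a unit. Thus 1
    lies in J, which means that I contains a power of y.\<close>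
  then have "\<And>a. a \<in> I \<Longrightarrow> c dvd a" using IJ by blast
  then have "is_unit c" by (rule cop)
  then obtain e where e: "1 = c * e" unfolding dvd_def by blast
  from c(1) obtain n where "germ_y ^ n * c \<in> I" unfolding J_def by blast
  then have "e * (germ_y ^ n * c) \<in> I" by (rule ideal.subspace_scale[OF I])
  moreover have "e * (germ_y ^ n * c) = germ_y ^ n * (c * e)" by (simp only: mult_ac)
  ultimately have "germ_y ^ n * 1 \<in> I" unfolding e by (simp only:)
  then have "germ_y ^ n \<in> I" by simp
  then show ?thesis by blast
qed

text \<open>I contains y^n and an element a not divisible by y. Division by a bounds the degree in x
  by d, and y^n cuts off the degree in y, so the monomials in a d by n box generate the
  quotient.\<close>

lemma ex_basis_modulo_ideal:
  assumes I: "ideal.subspace I" and cop: "\<And>c. (\<And>a. a \<in> I \<Longrightarrow> c dvd a) \<Longrightarrow> is_unit c"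
  shows "\<exists>B. germ.basis_modulo I B"
proof -
  obtain n where n: "germ_y ^ n \<in> I" using germ_y_power_in_ideal[OF assms] by blast
  have "\<not> is_unit germ_y" by (simp add: is_unit_germ_iff)
  then obtain a where a: "a \<in> I" "\<not> germ_y dvd a" using cop by blast
  define d where "d = subdegree (series_of a $ 0)"
  define B where "B = (\<lambda>(i, j). germ_x ^ i * germ_y ^ j) ` ({..<d} \<times> {..<n})"
  show ?thesis
  proof (rule germ.ex_basis_modulo)
    show "germ.subspace I" using I by (rule ideal_imp_subspace)
    show "finite B" by (simp add: B_def)
    fix v
    obtain q r where qr: "v = q * a + r" "\<And>i j. i \<ge> d \<Longrightarrow> series_of r $ j $ i = 0"
      using weierstrass_division[OF a(2)] unfolding d_def by blast
    define w where
      "w = (\<Sum>j<n. \<Sum>i<d. cscale (series_of r $ j $ i) (germ_x ^ i * germ_y ^ j))"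
    have "w \<in> germ.span B"
      unfolding w_def B_def by (intro germ.span_sum germ.span_scale germ.span_base) auto
    have "series_of w $ j' $ i' = series_of r $ j' $ i'" if "j' < n" for i' j'
    proof -
      have "series_of w $ j' $ i'
          = (\<Sum>j<n. if j = j' then \<Sum>i<d. if i = i' then series_of r $ j $ i else 0 else 0)"
        unfolding w_def series_of_sum fps_sum_nth series_of_monomial
        by (rule sum.cong[OF refl]) auto
      also have "\<dots> = series_of r $ j' $ i'" using that qr(2) by (auto simp: not_less)
      finally show ?thesis .
    qed
    then have "germ_y ^ n dvd r - w" by (auto simp: germ_y_power_dvd_iff fps_eq_iff)
    then obtain e where e: "r - w = e * germ_y ^ n" by (metis dvdE mult.commute)
    have "q * a + e * germ_y ^ n \<in> I"
      using a(1) n by (intro ideal.subspace_add[OF I] ideal.subspace_scale[OF I])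
    moreover have "v - w = q * a + e * germ_y ^ n" using qr(1) e by (simp add: algebra_simps)
    ultimately have "v - w \<in> I" by (simp only:)
    then show "\<exists>w \<in> germ.span B. v - w \<in> I"
      using \<open>w \<in> germ.span B\<close> by (rule bexI)
  qed
qed

lemma mem_ideal_span_pair_iff: "z \<in> ideal.span {a, b} \<longleftrightarrow> (\<exists>s t. z = s * a + t * b)"
proof -
  have eq: "z - s * a = t * b \<longleftrightarrow> z = s * a + t * b" for s t
    by (simp only: diff_eq_eq add.commute)
  show ?thesis
    unfolding ideal.span_breakdown_eq[of z a] ideal.span_singleton image_iff eq by blast
qed

lemma mem_ideal_sum_principal_iff:
  "z \<in> ideal_sum J (ideal.span {f}) \<longleftrightarrow> (\<exists>a \<in> J. \<exists>t. z = a + t * f)"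
  unfolding ideal_sum_def ideal.span_singleton by blast

lemma subspace_ideal_sum:
  assumes "ideal.subspace I" "ideal.subspace J"
  shows "ideal.subspace (ideal_sum I J)"
proof -
  have "ideal.span I = I" "ideal.span J = J" using assms by (simp_all only: ideal.span_eq_iff)
  then have "ideal_sum I J = ideal.span (I \<union> J)"
    unfolding ideal_sum_def by (simp only: ideal.span_Un)
  then show ?thesis by (simp only: ideal.subspace_span)
qed

section \<open>Prime germs, and cancellation modulo products of primes\<close>

lemma prime_power_dvd_mult_cancel:
  fixes p :: "'a :: algebraic_semidom"
  assumes "prime_elem p" "\<not> p dvd a" "p ^ n dvd a * b"
  shows "p ^ n dvd b"
  using assms(3)
proof (induction n arbitrary: b)
  case (Suc n)
  then have "p dvd a * b" by (metis dvd_mult_left power_Suc)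
  then have "p dvd b" using assms prime_elem_dvd_multD by blast
  then obtain c where c: "b = p * c" by (elim dvdE)
  have "p * p ^ n dvd p * (a * c)" using Suc.prems by (simp add: c mult.left_commute)
  then have "p ^ n dvd a * c" using prime_elem_not_zeroI[OF assms(1)] by simp
  then have "p ^ n dvd c" by (rule Suc.IH)
  then show ?case by (simp add: c mult_dvd_mono)
qed simp

text \<open>If p does not divide c, their common divisors are units, so some y^n has the form s p +
  t c. Multiplying by b gives p dvd b y^n, and y^n can be cancelled unless y divides p. In that case
  p is y up to a unit.\<close>

lemma irreducible_germ_imp_prime_elem:
  fixes p :: germ2
  assumes p: "irreducible p"
  shows "prime_elem p"
proof (rule prime_elemI)
  show "p \<noteq> 0" "\<not> is_unit p" using p by (auto simp: irreducible_def)
  fix b c assume bc: "p dvd b * c"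
  have y: "p dvd germ_y" if "germ_y dvd p"
  proof -
    from that obtain v where v: "p = germ_y * v" by (elim dvdE)
    moreover have "\<not> is_unit germ_y" by (simp add: is_unit_germ_iff)
    ultimately have "is_unit v" using irreducibleD[OF p] by blast
    then show ?thesis unfolding v by (simp add: mult_unit_dvd_iff)
  qed
  show "p dvd b \<or> p dvd c"
  proof (rule disjCI)
    assume nc: "\<not> p dvd c"
    show "p dvd b"
    proof (cases "germ_y dvd p")
      case True
      have "p dvd germ_y" using True by (rule y)
      have "germ_y dvd b * c" using True bc by (rule dvd_trans)
      then consider "germ_y dvd b" | "germ_y dvd c"
        using prime_elem_dvd_multD[OF prime_elem_germ_y] by blast
      then show ?thesis
      proof cases
        case 1
        with \<open>p dvd germ_y\<close> show ?thesis by (rule dvd_trans)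
      next
        case 2
        with \<open>p dvd germ_y\<close> have "p dvd c" by (rule dvd_trans)
        with nc show ?thesis by contradiction
      qed
    next
      case False
      have "is_unit e" if e: "\<And>a. a \<in> ideal.span {p, c} \<Longrightarrow> e dvd a" for e
      proof -
        have "e dvd p" "e dvd c" by (simp_all add: e ideal.span_base)
        then have "\<not> p dvd e" using nc dvd_trans by blast
        with irreducibleD'[OF p \<open>e dvd p\<close>] show ?thesis by blast
      qed
      from germ_y_power_in_ideal[OF ideal.subspace_span[of "{p, c}"] this]
      obtain n s t where n: "germ_y ^ n = s * p + t * c"
        unfolding mem_ideal_span_pair_iff by blast
      have "b * (s * p + t * c) = (b * s) * p + t * (b * c)"
        by (simp add: algebra_simps)
      then have "p dvd b * (s * p + t * c)" using bc by (simp only: dvd_add dvd_mult dvd_refl)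
      then have "p dvd b * germ_y ^ n" unfolding n .
      then obtain q where q: "b * germ_y ^ n = p * q" by (elim dvdE)
      have "germ_y ^ n dvd p * q" unfolding q[symmetric] by (rule dvd_triv_right)
      then have "germ_y ^ n dvd q"
        by (rule prime_power_dvd_mult_cancel[OF prime_elem_germ_y False])
      then obtain r where r: "q = germ_y ^ n * r" by (elim dvdE)
      have "b * germ_y ^ n = (p * r) * germ_y ^ n" unfolding q r by (simp only: mult_ac)
      moreover have "germ_y \<noteq> 0" using prime_elem_germ_y by (rule prime_elem_not_zeroI)
      ultimately have "b = p * r" by simp
      then show ?thesis by simp
    qed
  qed
qed

text \<open>For nonzero c the cofactors satisfy x^k e = y^k d, so y^k divides e and can be
  cancelled. This will show that multiplying an ideal by the k-th power of the maximal ideal creates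
  no new common divisors.\<close>

lemma dvd_if_dvd_mult_germ_x_germ_y_power:
  assumes "c dvd a * germ_x ^ k" "c dvd a * germ_y ^ k"
  shows "c dvd a"
proof -
  from assms obtain d e where d: "a * germ_x ^ k = c * d" and e: "a * germ_y ^ k = c * e"
    by (elim dvdE)
  show ?thesis
  proof (cases "c = 0")
    case True
    then show ?thesis using e prime_elem_not_zeroI[OF prime_elem_germ_y] by simp
  next
    case False
    have "c * (germ_x ^ k * e) = germ_x ^ k * (a * germ_y ^ k)"
      unfolding e by (simp only: mult_ac)
    also have "\<dots> = (a * germ_x ^ k) * germ_y ^ k" by (simp only: mult_ac)
    also have "\<dots> = c * (germ_y ^ k * d)" unfolding d by (simp only: mult_ac)
    finally have "germ_x ^ k * e = germ_y ^ k * d" using False by simp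
    then have "germ_y ^ k dvd germ_x ^ k * e" by simp
    moreover have "\<not> germ_y dvd germ_x ^ k"
      using not_germ_y_dvd_germ_x prime_elem_dvd_power[OF prime_elem_germ_y] by blast
    ultimately have "germ_y ^ k dvd e"
      by (rule prime_power_dvd_mult_cancel[OF prime_elem_germ_y, rotated])
    then obtain r where r: "e = germ_y ^ k * r" by (elim dvdE)
    have "a * germ_y ^ k = (c * r) * germ_y ^ k" unfolding e r by (simp only: mult_ac)
    moreover have "germ_y \<noteq> 0" using prime_elem_germ_y by (rule prime_elem_not_zeroI)
    ultimately show ?thesis by simp
  qed
qed

text \<open>The primes are split off one at a time: each divides c because it does not divide g. For
  the equation f of the curve this says that g is not a zero divisor modulo f.\<close>

lemma prod_prime_elems_dvd_cancel:
  fixes g :: "'a :: algebraic_semidom"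
  assumes "finite A" "\<And>p. p \<in> A \<Longrightarrow> prime_elem p" "\<And>p. p \<in> A \<Longrightarrow> \<not> p dvd g" "\<Prod>A dvd g * c"
  shows "\<Prod>A dvd c"
  using assms
proof (induction A arbitrary: c rule: finite_induct)
  case (insert p A)
  have p: "prime_elem p" "\<not> p dvd g" using insert.prems by auto
  have *: "p * \<Prod>A dvd g * c" using insert by simp
  then have "p dvd g * c" by (rule dvd_mult_left)
  then obtain d where d: "c = p * d" using p prime_elem_dvd_multD by (blast elim: dvdE)
  have "p * \<Prod>A dvd p * (g * d)" using * by (simp add: d mult.left_commute)
  then have "\<Prod>A dvd g * d" using prime_elem_not_zeroI[OF p(1)] by simp
  then have "\<Prod>A dvd d" using insert by blast
  then show ?case using insert.hyps by (simp add: d mult_dvd_mono)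
qed simp

text \<open>Write the product as c e and apply the cancellation lemma: the product divides e, and
  dividing it out leaves c times a cofactor equal to 1.\<close>

lemma is_unit_if_dvd_prod_prime_elems:
  fixes c :: "'a :: algebraic_semidom"
  assumes "finite A" "\<And>p. p \<in> A \<Longrightarrow> prime_elem p" "\<And>p. p \<in> A \<Longrightarrow> \<not> p dvd c" "c dvd \<Prod>A"
  shows "is_unit c"
proof -
  from assms(4) obtain e where e: "\<Prod>A = c * e" by (elim dvdE)
  then have "\<Prod>A dvd c * e" by simp
  then have "\<Prod>A dvd e" using assms by (intro prod_prime_elems_dvd_cancel[of A c e])
  then obtain d where d: "e = \<Prod>A * d" by (elim dvdE)
  have "\<Prod>A \<noteq> 0" using assms(1,2) prime_elem_not_zeroI by auto
  moreover have "\<Prod>A * 1 = \<Prod>A * (c * d)" using e d by (metis mult.left_commute mult.right_neutral)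
  ultimately have "1 = c * d" by (metis mult_left_cancel)
  then show ?thesis by (rule dvdI)
qed

section \<open>Partial derivatives and generic linear combinations\<close>

lemma series_of_dx: "series_of (dx a) $ j $ i = of_nat (Suc i) * series_of a $ j $ Suc i"
  by (simp add: dx.rep_eq fps2_deriv_x_def)

lemma series_of_dy: "series_of (dy a) $ j $ i = of_nat (Suc j) * series_of a $ Suc j $ i"
  unfolding dy.rep_eq fps2_deriv_y_def fps_deriv_nth fps_of_nat[symmetric] Suc_eq_plus1[symmetric]
  by (simp only: fps_mult_left_const_nth)

lemma dx_mult: "dx (a * b) = dx a * b + a * dx b"
proof -
  have "series_of (dx (a * b)) = series_of (dx a * b + a * dx b)"
    by (rule fps_ext)
      (simp add: dx.rep_eq fps2_deriv_x_def fps_mult_nth fps_deriv_sum sum.distrib add.commute)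
  then show ?thesis by (simp only: series_of_inject)
qed

lemma dy_mult: "dy (a * b) = dy a * b + a * dy b"
proof -
  have "series_of (dy (a * b)) = series_of (dy a * b + a * dy b)"
    by (simp add: dy.rep_eq fps2_deriv_y_def add.commute)
  then show ?thesis by (simp only: series_of_inject)
qed

text \<open>Otherwise all partial derivatives of \<open>p\<close> would be multiples of \<open>p\<close> and hence vanish at the
  origin.\<close>

lemma not_dvd_dx_dy:
  assumes "p \<noteq> 0" "\<not> is_unit p"
  shows "\<not> (p dvd dx p \<and> p dvd dy p)"
proof
  assume *: "p dvd dx p \<and> p dvd dy p"
  have dx: "p dvd dx a" and dy: "p dvd dy a" if "p dvd a" for a
    using that * by (auto elim!: dvdE simp: dx_mult dy_mult)
  have zero: "series_of a $ 0 $ 0 = 0" if "p dvd a" for a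
    using that assms(2) by (auto elim!: dvdE simp: is_unit_germ_iff)
  \<comment> \<open>The induction varies \<open>a\<close>: the coefficient at x^(i+1) is, up to the
    factor i+1, the coefficient at x^i of \<open>dx a\<close>, again a multiple of p. The exponent
    of y is then treated likewise.\<close>
  have zero_x: "series_of a $ 0 $ i = 0" if "p dvd a" for i a
    using that
  proof (induction i arbitrary: a)
    case (Suc i)
    have "of_nat (Suc i) * series_of a $ 0 $ Suc i = 0"
      using Suc.IH[OF dx[OF Suc.prems]] by (simp only: series_of_dx)
    then show ?case by (simp del: of_nat_Suc)
  qed (rule zero)
  have "series_of a $ j $ i = 0" if "p dvd a" for i j a
    using that
  proof (induction j arbitrary: a)
    case (Suc j)
    have "of_nat (Suc j) * series_of a $ Suc j $ i = 0"
      using Suc.IH[OF dy[OF Suc.prems]] by (simp only: series_of_dy)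
    then show ?case by (simp del: of_nat_Suc)
  qed (rule zero_x)
  then have "series_of p = 0" by (intro fps_ext) simp
  with assms(1) show False by simp
qed

lemma is_unit_const: "z \<noteq> 0 \<Longrightarrow> is_unit (const z)"
  by (simp add: is_unit_germ_iff)

text \<open>At most one t occurs: for two distinct values s and t, p divides (s - t) b, where s - t
  is a unit, hence p divides b and then a.\<close>

lemma finite_const_combination_dvd:
  assumes "\<not> (p dvd a \<and> p dvd b)"
  shows "finite {t. p dvd a + const t * b}"
proof -
  have "s = t" if s: "p dvd a + const s * b" and t: "p dvd a + const t * b" for s t
  proof (rule ccontr)
    assume "s \<noteq> t"
    then have "is_unit (const (s - t))" by (intro is_unit_const) simp
    have "const s = const (s - t) + const t" by (simp flip: const_simps)
    then have "const (s - t) * b = (a + const s * b) - (a + const t * b)"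
      by (simp add: distrib_right)
    then have "p dvd const (s - t) * b" using dvd_diff[OF s t] by (simp only:)
    then have "p dvd b" using \<open>is_unit (const (s - t))\<close> by (simp add: dvd_mult_unit_iff')
    moreover from this have "p dvd a" using t by (simp add: dvd_add_left_iff)
    ultimately show False using assms by blast
  qed
  then have "{t. p dvd a + const t * b} \<subseteq> {SOME t. p dvd a + const t * b}"
    by (metis (mono_tags, lifting) mem_Collect_eq singletonI someI subsetI)
  then show ?thesis by (rule finite_subset) simp
qed

lemma germ_x_power_mem: "germ_x ^ k \<in> max_ideal_power k"
proof (induction k)
  case (Suc k)
  have "germ_x \<in> max_ideal" by (simp add: max_ideal_def)
  with Suc show ?case by (auto simp: ideal_prod_def intro!: ideal.span_base)
qed simp

lemma germ_y_power_mem: "germ_y ^ k \<in> max_ideal_power k"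
proof (induction k)
  case (Suc k)
  have "germ_y \<in> max_ideal" by (simp add: max_ideal_def)
  with Suc show ?case by (auto simp: ideal_prod_def intro!: ideal.span_base)
qed simp

section \<open>Invariance of a union of separatrices\<close>

lemma wedge_differential_mult:
  "wedge \<omega> (differential (a * b)) = a * wedge \<omega> (differential b) + b * wedge \<omega> (differential a)"
  by (simp add: wedge_def differential_def dx_mult dy_mult algebra_simps)

lemma invariant_curve_iff: "invariant_curve \<omega> f \<longleftrightarrow> f dvd wedge \<omega> (differential f)"
  by (simp add: invariant_curve_def dvd_def)

lemma invariant_curve_mult:
  assumes "invariant_curve \<omega> a" "invariant_curve \<omega> b"
  shows "invariant_curve \<omega> (a * b)"
proof -
  have "a * b dvd a * wedge \<omega> (differential b)" "b * a dvd b * wedge \<omega> (differential a)"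
    using assms unfolding invariant_curve_iff by (simp_all only: mult_dvd_mono dvd_refl)
  then show ?thesis
    unfolding invariant_curve_iff wedge_differential_mult by (simp only: mult.commute[of b a] dvd_add)
qed

lemma invariant_curve_unit: "is_unit u \<Longrightarrow> invariant_curve \<omega> u"
  unfolding invariant_curve_iff by (rule unit_imp_dvd)

lemma invariant_curve_prod:
  "(\<And>p. p \<in> A \<Longrightarrow> invariant_curve \<omega> p) \<Longrightarrow> invariant_curve \<omega> (\<Prod>A)"
  by (induction A rule: infinite_finite_induct)
    (auto intro: invariant_curve_mult invariant_curve_unit)

section \<open>Colengths of ideals\<close>

lemma cscale_mult_right: "cscale z (a * b) = a * cscale z b"
  unfolding cscale_def by (simp only: mult_ac)

text \<open>Multiplication by \<open>g\<close> is injective modulo \<open>f\<close>, so the colength of \<open>g J + (f)\<close> is the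
  colength of \<open>J + (f)\<close> plus that of \<open>(f, g)\<close>.\<close>

lemma basis_modulo_scaled_ideal:
  fixes f g :: germ2
  assumes J: "ideal.subspace J" and inj: "\<And>c. f dvd g * c \<Longrightarrow> f dvd c"
    and B: "germ.basis_modulo (ideal_sum J (ideal.span {f})) B"
    and D: "germ.basis_modulo (ideal.span {f, g}) D"
  shows "germ.basis_modulo (ideal_sum ((*) g ` J) (ideal.span {f})) (D \<union> (*) g ` B)"
    and "card (D \<union> (*) g ` B) = card D + card B"
proof -
  define W where "W = ideal_sum J (ideal.span {f})"
  have mem_W: "c \<in> W" if "f dvd c - a" "a \<in> J" for a c
  proof -
    from that obtain t where "c - a = f * t" by (elim dvdE)
    then have "c = a + t * f" by (simp add: algebra_simps)
    then show ?thesis unfolding W_def mem_ideal_sum_principal_iff using that by blast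
  qed
  have J0: "0 \<in> J" using J by (rule ideal.subspace_0)
  have fin: "finite B" "finite D" using B D by (auto simp: germ.basis_modulo_def)
  have injB: "inj_on ((*) g) B"
  proof (rule inj_onI, rule ccontr)
    fix b c assume bc: "b \<in> B" "c \<in> B" "g * b = g * c" "b \<noteq> c"
    then have "f dvd g * (b - c)" by (simp add: right_diff_distrib)
    then have "f dvd b - c" by (rule inj)
    then have "b - c \<in> W" by (intro mem_W[OF _ J0]) simp
    with germ.basis_modulo_diff_not_mem[OF B bc(1,2,4)] show False by (simp add: W_def)
  qed
  have disj: "D \<inter> (*) g ` B = {}"
  proof -
    have "g * b \<in> ideal.span {f, g}" for b
      by (subst mult.commute) (intro ideal.span_scale ideal.span_base, simp)
    then show ?thesis using germ.basis_modulo_not_mem[OF D] by blast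
  qed
  show "card (D \<union> (*) g ` B) = card D + card B"
    using fin disj injB by (simp add: card_Un_disjoint card_image)
  \<comment> \<open>The exact sequence behind the union: multiplication by g embeds O_2/(J + (f))
    into O_2/(g J + (f)) with quotient O_2/(f,g). B accounts for the image, D for the
    quotient.\<close>
  show "germ.basis_modulo (ideal_sum ((*) g ` J) (ideal.span {f})) (D \<union> (*) g ` B)"
    unfolding germ.basis_modulo_iff_span
  proof (intro conjI allI impI)
    show "finite (D \<union> (*) g ` B)" using fin by simp
    fix v
    obtain s where s: "s \<in> germ.span D" "v - s \<in> ideal.span {f, g}"
      using D unfolding germ.basis_modulo_iff_span by blast
    then obtain p q where pq: "v - s = p * f + q * g" unfolding mem_ideal_span_pair_iff by blast
    obtain w where w: "w \<in> germ.span B" "q - w \<in> W"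
      using B unfolding germ.basis_modulo_iff_span W_def by blast
    then obtain a t where at: "a \<in> J" "q - w = a + t * f"
      unfolding W_def mem_ideal_sum_principal_iff by blast
    have "g * w \<in> germ.span ((*) g ` B)"
    proof -
      obtain u where u: "w = (\<Sum>b\<in>B. cscale (u b) b)"
        using w(1) fin by (auto simp: germ.span_finite)
      have "g * w = (\<Sum>b\<in>B. cscale (u b) (g * b))"
        unfolding u by (simp only: sum_distrib_left cscale_mult_right)
      also have "\<dots> \<in> germ.span ((*) g ` B)"
        by (intro germ.span_sum germ.span_scale germ.span_base imageI)
      finally show ?thesis .
    qed
    then have "s + g * w \<in> germ.span (D \<union> (*) g ` B)"
      using s(1) germ.span_mono[of D "D \<union> (*) g ` B"] germ.span_mono[of "(*) g ` B" "D \<union> (*) g ` B"]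
      by (intro germ.span_add) auto
    moreover have "v - (s + g * w) \<in> ideal_sum ((*) g ` J) (ideal.span {f})"
    proof -
      have "v - (s + g * w) = p * f + g * (q - w)"
        using pq by (simp add: algebra_simps)
      also have "\<dots> = g * a + (p + g * t) * f" unfolding at(2) by (simp add: algebra_simps)
      finally show ?thesis unfolding mem_ideal_sum_principal_iff using at(1) by blast
    qed
    ultimately show "\<exists>w \<in> germ.span (D \<union> (*) g ` B).
        v - w \<in> ideal_sum ((*) g ` J) (ideal.span {f})" by (rule bexI[rotated])
  next
    fix u assume u: "(\<Sum>b\<in>D \<union> (*) g ` B. cscale (u b) b) \<in> ideal_sum ((*) g ` J) (ideal.span {f})"
    define S where "S = (\<Sum>b\<in>D. cscale (u b) b)"
    define T where "T = (\<Sum>b\<in>B. cscale (u (g * b)) b)"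
    have "(\<Sum>b\<in>D \<union> (*) g ` B. cscale (u b) b) = S + (\<Sum>b\<in>(*) g ` B. cscale (u b) b)"
      unfolding S_def using fin disj by (simp add: sum.union_disjoint)
    also have "(\<Sum>b\<in>(*) g ` B. cscale (u b) b) = g * T"
      unfolding T_def sum.reindex[OF injB] o_def by (simp only: sum_distrib_left cscale_mult_right)
    finally obtain a t where at: "a \<in> J" "S + g * T = g * a + t * f"
      using u unfolding mem_ideal_sum_principal_iff by auto
    \<comment> \<open>Modulo (f,g) only \<open>S\<close> survives, so the coefficients on D vanish.
      Then g is cancelled modulo f, which leaves a relation on B modulo J + (f).\<close>
    have "S = t * f + (a - T) * g" using at(2) by (simp add: algebra_simps)
    then have "S \<in> ideal.span {f, g}" unfolding mem_ideal_span_pair_iff by blast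
    then have uD: "\<forall>b\<in>D. u b = 0" using D unfolding S_def germ.basis_modulo_def by blast
    then have "S = 0" unfolding S_def by (intro sum.neutral) simp
    then have "g * (T - a) = f * t" using at(2) by (simp add: algebra_simps)
    then have "f dvd g * (T - a)" by (rule dvdI)
    then have "f dvd T - a" by (rule inj)
    then have "T \<in> W" using at(1) by (rule mem_W)
    then have "\<forall>b\<in>B. u (g * b) = 0"
      using B unfolding T_def W_def germ.basis_modulo_def by (elim conjE allE) (erule mp)
    then show "\<forall>b\<in>D \<union> (*) g ` B. u b = 0" using uD by blast
  qed
qed

section \<open>Comparison of the ideals g J + (f) and h K + (f), and finiteness of the
  colengths\<close>

lemma subspace_ideal_prod: "ideal.subspace (ideal_prod I J)"
  unfolding ideal_prod_def by (rule ideal.subspace_span)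

lemma subspace_mult_image:
  assumes "ideal.subspace J"
  shows "ideal.subspace ((*) g ` J)"
proof (rule ideal.subspaceI)
  show "0 \<in> (*) g ` J" using ideal.subspace_0[OF assms] by (intro image_eqI[of _ _ 0]) simp_all
next
  fix x y assume "x \<in> (*) g ` J" "y \<in> (*) g ` J"
  then obtain a b where "a \<in> J" "b \<in> J" "x = g * a" "y = g * b" by blast
  then show "x + y \<in> (*) g ` J"
    using ideal.subspace_add[OF assms] by (intro image_eqI[of _ _ "a + b"]) (simp_all only: distrib_left)
next
  fix c x assume "x \<in> (*) g ` J"
  then obtain a where "a \<in> J" "x = g * a" by blast
  then show "c * x \<in> (*) g ` J"
    using ideal.subspace_scale[OF assms] by (intro image_eqI[of _ _ "c * a"]) (simp_all only: mult_ac)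
qed

text \<open>The hypotheses are congruences modulo f. With K the product ideal on the right, all z
  with g z in h K + (f) form an ideal, and by linearity it contains the generators of the product
  ideal on the left.\<close>

lemma scaled_ideal_prod_le:
  assumes "g * a = h * c + f * s" "g * b = h * d + f * t"
  shows "ideal_sum ((*) g ` ideal_prod (ideal.span {a, b}) M) (ideal.span {f})
    \<subseteq> ideal_sum ((*) h ` ideal_prod (ideal.span {c, d}) M) (ideal.span {f})" (is "?L \<subseteq> ?R")
proof -
  let ?K = "ideal_prod (ideal.span {c, d}) M"
  have K: "ideal.subspace ?K" by (rule subspace_ideal_prod)
  define N where "N = {z. \<exists>k \<in> ?K. \<exists>r. g * z = h * k + f * r}"
  have "ideal_prod (ideal.span {a, b}) M \<subseteq> N"
    unfolding ideal_prod_def[of "ideal.span {a, b}"]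
  proof (rule ideal.span_minimal)
    show "{x * y |x y. x \<in> ideal.span {a, b} \<and> y \<in> M} \<subseteq> N"
    proof safe
      fix x y assume "x \<in> ideal.span {a, b}" and y: "y \<in> M"
      then obtain p q where x: "x = p * a + q * b" unfolding mem_ideal_span_pair_iff by blast
      have "p * c + q * d \<in> ideal.span {c, d}" unfolding mem_ideal_span_pair_iff by blast
      then have k: "(p * c + q * d) * y \<in> ?K"
        unfolding ideal_prod_def using y by (intro ideal.span_base) blast
      have "g * (x * y) = (p * (g * a) + q * (g * b)) * y"
        unfolding x by (simp add: algebra_simps)
      also have "\<dots> = h * ((p * c + q * d) * y) + f * ((p * s + q * t) * y)"
        unfolding assms by (simp add: algebra_simps)
      finally show "x * y \<in> N" unfolding N_def using k by blast
    qed
    show "ideal.subspace N"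
    proof (rule ideal.subspaceI)
      have "g * 0 = h * 0 + f * 0" by simp
      then show "0 \<in> N" unfolding N_def using ideal.subspace_0[OF K] by blast
    next
      fix x y assume "x \<in> N" "y \<in> N"
      then obtain k r l q where *: "k \<in> ?K" "l \<in> ?K" "g * x = h * k + f * r" "g * y = h * l + f * q"
        unfolding N_def by blast
      have "g * (x + y) = h * (k + l) + f * (r + q)"
        unfolding distrib_left *(3,4) by (simp only: add_ac)
      then show "x + y \<in> N" unfolding N_def using ideal.subspace_add[OF K *(1,2)] by blast
    next
      fix e x assume "x \<in> N"
      then obtain k r where *: "k \<in> ?K" "g * x = h * k + f * r" unfolding N_def by blast
      have "g * (e * x) = e * (g * x)" by (simp only: mult_ac)
      also have "\<dots> = h * (e * k) + f * (e * r)" unfolding *(2) by (simp add: algebra_simps)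
      finally show "e * x \<in> N" unfolding N_def using ideal.subspace_scale[OF K *(1)] by blast
    qed
  qed
  then have N: "\<exists>k \<in> ?K. \<exists>r. g * z = h * k + f * r" if "z \<in> ideal_prod (ideal.span {a, b}) M" for z
    using that unfolding N_def by blast
  show ?thesis
  proof
    fix z assume "z \<in> ?L"
    then obtain x e where x: "x \<in> ideal_prod (ideal.span {a, b}) M" "z = g * x + e * f"
      unfolding mem_ideal_sum_principal_iff by blast
    then obtain k r where k: "k \<in> ?K" "g * x = h * k + f * r" using N by blast
    have "z = h * k + (r + e) * f" unfolding x(2) k(2) by (simp add: algebra_simps)
    then show "z \<in> ?R" unfolding mem_ideal_sum_principal_iff using k(1) by blast
  qed
qed

lemma scaled_ideal_prod_eq:
  assumes "g * a = h * c + f * s" "g * b = h * d + f * t"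
  shows "ideal_sum ((*) g ` ideal_prod (ideal.span {a, b}) M) (ideal.span {f})
    = ideal_sum ((*) h ` ideal_prod (ideal.span {c, d}) M) (ideal.span {f})"
proof (rule equalityI)
  have "h * c = g * a + f * (- s)" "h * d = g * b + f * (- t)" using assms by simp_all
  then show "ideal_sum ((*) h ` ideal_prod (ideal.span {c, d}) M) (ideal.span {f})
    \<subseteq> ideal_sum ((*) g ` ideal_prod (ideal.span {a, b}) M) (ideal.span {f})"
    by (rule scaled_ideal_prod_le)
qed (rule scaled_ideal_prod_le[OF assms])

text \<open>A common divisor of the ideal divides a x^k and a y^k, hence a, and likewise b; it also
  divides f. So the power of the maximal ideal does not disturb the finiteness of the
  colength.\<close>

lemma ex_basis_modulo_tau_ideal:
  assumes "\<And>c. c dvd a \<Longrightarrow> c dvd b \<Longrightarrow> c dvd f \<Longrightarrow> is_unit c"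
  shows "\<exists>B. germ.basis_modulo
    (ideal_sum (ideal_prod (ideal.span {a, b}) (max_ideal_power k)) (ideal.span {f})) B"
proof (rule ex_basis_modulo_ideal)
  let ?J = "ideal_prod (ideal.span {a, b}) (max_ideal_power k)"
  show "ideal.subspace (ideal_sum ?J (ideal.span {f}))"
    by (intro subspace_ideal_sum subspace_ideal_prod ideal.subspace_span)
  fix c assume c: "\<And>z. z \<in> ideal_sum ?J (ideal.span {f}) \<Longrightarrow> c dvd z"
  have dvd_prod: "c dvd x * y" if "x \<in> {a, b}" "y \<in> max_ideal_power k" for x y
  proof (rule c)
    have "x \<in> ideal.span {a, b}" using that(1) by (rule ideal.span_base)
    then have "x * y \<in> ?J"
      unfolding ideal_prod_def using that(2) by (intro ideal.span_base) blast
    moreover have "x * y = x * y + 0 * f" by simp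
    ultimately show "x * y \<in> ideal_sum ?J (ideal.span {f})"
      unfolding mem_ideal_sum_principal_iff by blast
  qed
  have "c dvd a" "c dvd b"
    by (rule dvd_if_dvd_mult_germ_x_germ_y_power[of _ _ k];
        simp add: dvd_prod germ_x_power_mem germ_y_power_mem)+
  moreover have "c dvd f"
  proof (rule c)
    have "f = 0 + 1 * f" by simp
    then show "f \<in> ideal_sum ?J (ideal.span {f})"
      unfolding mem_ideal_sum_principal_iff using ideal.subspace_0[OF subspace_ideal_prod] by blast
  qed
  ultimately show "is_unit c" by (rule assms)
qed

lemma ex_basis_modulo_coprime:
  assumes "coprime a b"
  shows "\<exists>B. germ.basis_modulo (ideal.span {a, b}) B"
proof (rule ex_basis_modulo_ideal[OF ideal.subspace_span])
  fix c assume "\<And>z. z \<in> ideal.span {a, b} \<Longrightarrow> c dvd z"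
  then have "c dvd a" "c dvd b" by (simp_all add: ideal.span_base)
  then show "is_unit c" using assms by (rule coprime_common_divisor[rotated])
qed

lemma quot_dim_ideal:
  "ideal.subspace I \<Longrightarrow> germ.basis_modulo I B \<Longrightarrow> germ.quot_dim I = enat (card B)"
  by (intro germ.quot_dim_eq_card ideal_imp_subspace)

lemma separatrix_imp_prime_elem: "separatrix \<omega> p \<Longrightarrow> prime_elem p"
  by (simp add: separatrix_def irreducible_germ_imp_prime_elem)

section \<open>Branches of the curve, and the count of colengths\<close>

theorem theorem8p2:
  fixes \<omega> :: one_form and f :: germ2 and k :: nat
  assumes "singular_foliation \<omega>"
    and "reduced_curve_of_separatrices \<omega> f"
  shows "tau_foliation k \<omega> f \<noteq> \<infinity> \<and> tau_curve k f \<noteq> \<infinity> \<and>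
    int (the_enat (tau_foliation k \<omega> f)) - int (the_enat (tau_curve k f)) = GSV \<omega> f"
proof -
  obtain P Q where \<omega>: "\<omega> = (P, Q)" by (cases \<omega>)
  have PQ: "coprime P Q" using assms(1) by (simp add: singular_foliation_def \<omega>)
  obtain A u where A: "finite A" "\<And>p. p \<in> A \<Longrightarrow> separatrix \<omega> p"
    and u: "is_unit u" and f: "f = u * \<Prod>A" and sqf: "squarefree f"
    using assms(2) unfolding reduced_curve_of_separatrices_def by blast
  have prime: "prime_elem p" if "p \<in> A" for p using A(2)[OF that] by (rule separatrix_imp_prime_elem)
  have p_dvd: "p dvd f" if "p \<in> A" for p
    unfolding f using that A(1) by (intro dvd_mult dvd_prodI)
  have f_dvd: "f dvd c \<longleftrightarrow> \<Prod>A dvd c" for c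
    unfolding f using u by (simp add: mult_unit_dvd_iff')
  have dvd_f: "c dvd f \<longleftrightarrow> c dvd \<Prod>A" for c
    unfolding f using u by (simp add: dvd_mult_unit_iff')
  \<comment> \<open>Testing coprimality on the branches serves both the cancellation modulo f and
    the choice of a generic t.\<close>
  have coprime_iff: "coprime g f \<longleftrightarrow> (\<forall>p\<in>A. \<not> p dvd g)" for g
  proof
    assume "coprime g f"
    then show "\<forall>p\<in>A. \<not> p dvd g"
      using p_dvd prime_elem_not_unit[OF prime] coprime_common_divisor[of g f] by blast
  next
    assume *: "\<forall>p\<in>A. \<not> p dvd g"
    show "coprime g f"
    proof (rule coprimeI)
      fix c assume c: "c dvd g" "c dvd f"
      have "\<not> p dvd c" if "p \<in> A" for p using * that c(1) dvd_trans[of p c g] by blast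
      then show "is_unit c"
        using c(2) unfolding dvd_f by (intro is_unit_if_dvd_prod_prime_elems[OF A(1) prime])
    qed
  qed
  have inj: "f dvd c" if "coprime g f" "f dvd g * c" for g c
    using that prod_prime_elems_dvd_cancel[OF A(1) prime, of g c] unfolding coprime_iff f_dvd
    by (simp only: not_False_eq_True)
  \<comment> \<open>Otherwise write f = p e, where p does not divide e because f is squarefree; the
    product rule makes p divide both of its own partial derivatives.\<close>
  have deriv: "\<not> (p dvd dx f \<and> p dvd dy f)" if p: "p \<in> A" for p
  proof
    assume *: "p dvd dx f \<and> p dvd dy f"
    obtain e where e: "f = p * e" using p_dvd[OF p] by (elim dvdE)
    have np: "\<not> is_unit p" using prime[OF p] by (rule prime_elem_not_unit)
    have "\<not> p dvd e"
    proof
      assume "p dvd e"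
      then have "p ^ 2 dvd f" unfolding e power2_eq_square by (intro mult_dvd_mono dvd_refl)
      with sqf np show False unfolding squarefree_def by blast
    qed
    moreover have "p dvd dx p * e" "p dvd dy p * e"
      using * unfolding e dx_mult dy_mult by (simp_all add: dvd_add_left_iff)
    ultimately have "p dvd dx p" "p dvd dy p"
      using prime_elem_dvd_multD[OF prime[OF p]] by blast+
    with not_dvd_dx_dy[OF prime_elem_not_zeroI[OF prime[OF p]] np] show False by blast
  qed

  have tau_curve_cop: "is_unit c" if "c dvd dx f" "c dvd dy f" "c dvd f" for c
  proof -
    have "\<not> p dvd c" if "p \<in> A" for p
      using deriv[OF that] \<open>c dvd dx f\<close> \<open>c dvd dy f\<close> dvd_trans[of p c] by blast
    then show ?thesis
      using \<open>c dvd f\<close> unfolding dvd_f by (intro is_unit_if_dvd_prod_prime_elems[OF A(1) prime])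
  qed
  have tau_foliation_cop: "is_unit c" if "c dvd P" "c dvd Q" "c dvd f" for c
    using PQ that(1,2) by (rule coprime_common_divisor)

  define J where "J = ideal_prod (ideal.span {P, Q}) (max_ideal_power k)"
  define K where "K = ideal_prod (ideal.span {dx f, dy f}) (max_ideal_power k)"
  have JK: "ideal.subspace J" "ideal.subspace K" by (simp_all add: J_def K_def subspace_ideal_prod)
  have sub: "ideal.subspace (ideal_sum J (ideal.span {f}))" if "ideal.subspace J" for J
    using that by (intro subspace_ideal_sum ideal.subspace_span)
  obtain B where B: "germ.basis_modulo (ideal_sum J (ideal.span {f})) B"
    using ex_basis_modulo_tau_ideal[OF tau_foliation_cop, where k = k] unfolding J_def by blast
  obtain C where C: "germ.basis_modulo (ideal_sum K (ideal.span {f})) C"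
    using ex_basis_modulo_tau_ideal[OF tau_curve_cop, where k = k] unfolding K_def by blast
  have tau: "tau_foliation k \<omega> f = enat (card B)" "tau_curve k f = enat (card C)"
    using quot_dim_ideal[OF sub[OF JK(1)] B] quot_dim_ideal[OF sub[OF JK(2)] C]
    by (simp_all add: tau_foliation_def tau_curve_def \<omega> J_def K_def)

  \<comment> \<open>This holds for every admissible choice of g, h and \<eta>. The left side does
    not involve k, and the right side does not involve g and h.\<close>
  have GSV_value: "int (the_enat (inter_mult f h)) - int (the_enat (inter_mult f g))
      = int (card B) - int (card C)"
    if g: "coprime g f" and h: "coprime h f"
      and eq: "form_scale g \<omega> = form_scale h (differential f) + form_scale f \<eta>" for g h \<eta>
  proof -
    have gP: "g * P = h * dx f + f * fst \<eta>" and gQ: "g * Q = h * dy f + f * snd \<eta>"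
      using eq by (simp_all add: form_scale_def differential_def \<omega> plus_prod_def)
    obtain D where D: "germ.basis_modulo (ideal.span {f, g}) D"
      using ex_basis_modulo_coprime g coprime_commute by blast
    obtain E where E: "germ.basis_modulo (ideal.span {f, h}) E"
      using ex_basis_modulo_coprime h coprime_commute by blast
    have "ideal_sum ((*) g ` J) (ideal.span {f}) = ideal_sum ((*) h ` K) (ideal.span {f})"
      unfolding J_def K_def by (rule scaled_ideal_prod_eq[OF gP gQ])
    \<comment> \<open>Two bases modulo the same ideal, of sizes card D + card B and card E + card
      C.\<close>
    note 1 = basis_modulo_scaled_ideal[OF JK(1) inj[OF g] B D, unfolded this]
      and 2 = basis_modulo_scaled_ideal[OF JK(2) inj[OF h] C E]
    from sub[OF subspace_mult_image[OF JK(2)]]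
    have "germ.subspace (ideal_sum ((*) h ` K) (ideal.span {f}))"
      by (rule ideal_imp_subspace)
    from germ.basis_modulo_card_le[OF this 1(1) 2(1)] germ.basis_modulo_card_le[OF this 2(1) 1(1)]
    have "card D + card B = card E + card C" using 1(2) 2(2) by simp
    moreover have "inter_mult f g = enat (card D)" "inter_mult f h = enat (card E)"
      unfolding inter_mult_def using D E by (simp_all add: quot_dim_ideal ideal.subspace_span)
    ultimately show ?thesis by simp
  qed

  have "finite (\<Union>p\<in>A. {t. p dvd dx f + const t * dy f} \<union> {t. p dvd P + const t * Q})"
  proof (intro finite_UN_I finite_UnI finite_const_combination_dvd A(1))
    fix p assume p: "p \<in> A"
    show "\<not> (p dvd dx f \<and> p dvd dy f)" using p by (rule deriv)
    show "\<not> (p dvd P \<and> p dvd Q)"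
      using prime_elem_not_unit[OF prime[OF p]] coprime_common_divisor[OF PQ] by blast
  qed
  then obtain t where t: "t \<notin> (\<Union>p\<in>A. {t. p dvd dx f + const t * dy f} \<union> {t. p dvd P + const t * Q})"
    using ex_new_if_finite[OF infinite_UNIV_char_0] by blast
  define g where "g = dx f + const t * dy f"
  define h where "h = P + const t * Q"
  have gh: "coprime g f" "coprime h f" unfolding coprime_iff g_def h_def using t by blast+
  have "invariant_curve \<omega> f"
    unfolding f
  proof (rule invariant_curve_mult[OF invariant_curve_unit[OF u] invariant_curve_prod])
    fix p assume "p \<in> A"
    from A(2)[OF this] show "invariant_curve \<omega> p" by (simp add: separatrix_def)
  qed
  then obtain w where "wedge \<omega> (differential f) = f * w" unfolding invariant_curve_def by blast
  then have w: "P * dy f - Q * dx f = f * w" by (simp add: wedge_def differential_def \<omega>)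
  have "g * P = h * dx f + const t * (P * dy f - Q * dx f)"
    unfolding g_def h_def by (simp add: algebra_simps)
  also have "\<dots> = h * dx f + f * (const t * w)" unfolding w by (simp only: mult_ac)
  finally have gP: "g * P = h * dx f + f * (const t * w)" .
  have "g * Q = h * dy f - (P * dy f - Q * dx f)"
    unfolding g_def h_def by (simp add: algebra_simps)
  then have gQ: "g * Q = h * dy f + f * (- w)" unfolding w by simp
  have eq: "form_scale g \<omega> = form_scale h (differential f) + form_scale f (const t * w, - w)"
    using gP gQ by (simp add: form_scale_def differential_def \<omega> plus_prod_def)
  \<comment> \<open>\<open>GSV\<close> is a definite description: \<open>eq\<close> provides an
    admissible choice, and \<open>GSV_value\<close> shows that every other choice gives the same
    number.\<close>
  have "GSV \<omega> f = int (card B) - int (card C)"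
    unfolding GSV_def
  proof (rule the_equality)
    show "\<exists>g h \<eta>. coprime g f \<and> coprime h f \<and>
      form_scale g \<omega> = form_scale h (differential f) + form_scale f \<eta> \<and>
      int (card B) - int (card C) = int (the_enat (inter_mult f h)) - int (the_enat (inter_mult f g))"
      by (rule exI[of _ g], rule exI[of _ h], rule exI[of _ "(const t * w, - w)"])
        (intro conjI gh eq GSV_value[OF gh eq, symmetric])
  next
    fix n
    assume "\<exists>g h \<eta>. coprime g f \<and> coprime h f \<and>
      form_scale g \<omega> = form_scale h (differential f) + form_scale f \<eta> \<and>
      n = int (the_enat (inter_mult f h)) - int (the_enat (inter_mult f g))"
    then show "n = int (card B) - int (card C)" by (elim exE conjE) (simp only: GSV_value)
  qed
  then show ?thesis by (simp add: tau)
qed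

end
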